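(* In the multiple feature matching model described in the context, with $M\geq2$, $p\ge1$, $\sigma>0$ and $\bar\Delta>0$, the following minimax lower bounds hold. 1. (Perfect recovery.) There exist positive numerical constants $c$, $C$ and $K_0$ such that, if $\bar\Delta^2\leq c\left(\log(KM)+\sqrt{\frac pM\log(KM)}\right)$ and $K\geq K_0$, then $$\inf_{\hat\pi:\mathbb{R}^{K\times M\times p}\to(\mathcal{S}_K)^M}\ \sup_{\mu\in\Theta_{\bar\Delta}}\ \sup_{\pi^*\in(\mathcal{S}_K)^M}\mathbb{P}_{\mu,\pi^*}\left(err(\hat\pi,\pi^* )\neq0\right)\geq C .$$ 2. (Partial recovery.) There exist positive numerical constants $c$, $c'$, $C$ and $K_0$ such that, if $p\geq c\log(K)$, $K\geq K_0$ and $\bar\Delta^2\leq c'\left(\log(K)+\sqrt{\frac pM\log(K)}\right)$, then $$\inf_{\hat\pi:\mathbb{R}^{K\times M\times p}\to(\mathcal{S}_K)^M}\ \sup_{\mu\in\Theta_{\bar\Delta}}\ \sup_{\pi^*\in(\mathcal{S}_K)^M}\mathbb{E}_{\mu,\pi^*}\left[err(\hat\pi,\pi^* )\right]\geq C .$$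
   Context: $\mathcal{S}_K$ is the set of permutations of $[K]=\{1,\dots,K\}$. $\Theta_{\bar\Delta}$ is the set of $K$-tuples $\mu=(\mu_1,\ldots,\mu_K)\in(\mathbb{R}^p)^K$ such that $\min_{k\neq l}\frac{\|\mu_k-\mu_l\|^2}{2\sigma^2}\geq\bar\Delta^2$. For $\mu\in(\mathbb{R}^p)^K$ and $\pi=(\pi_1,\dots,\pi_M)\in(\mathcal{S}_K)^M$, $\mathbb{P}_{\mu,\pi}$ (with expectation $\mathbb{E}_{\mu,\pi}$) is the distribution of $Y=(Y_k^{(m)})_{k\in[K],m\in[M]}\in\mathbb{R}^{K\times M\times p}$ for which the $Y_k^{(m)}$ are independent with $Y_k^{(m)}\sim\mathcal{N}(\mu_{\pi_m(k)},\sigma^2I_p)$. Estimators $\hat\pi=\hat\pi(Y)$ are measurable maps. The error is $$err(\pi,\pi^* )=\min_{\psi\in\mathcal{S}_K}\frac{1}{KM}\sum_{k=1}^K\sum_{m=1}^M\mathbf{1}\{\psi(\pi_m(k))\neq\pi^*_m(k)\}.$$ *)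

theory Defs
  imports "HOL-Probability.Probability" "HOL-Combinatorics.Permutations"
begin

text \<open>
  The dimensions \<open>K\<close>, \<open>M\<close>, \<open>p\<close> are natural numbers rather than types, so that constants can be
  chosen uniformly in them.  Vectors of \<open>\<real>\<^sup>p\<close> are extensional functions on \<open>{1..p}\<close>, and
  observations \<open>Y\<close> are extensional functions sending \<open>(k, m)\<close> to the vector \<open>Y\<^sub>k\<^sup>(\<^sup>m\<^sup>)\<close>.
\<close>

definition perms :: "nat \<Rightarrow> (nat \<Rightarrow> nat) set" where
  "perms K = {\<psi>. \<psi> permutes {1..K}}"

definition perm_tuples :: "nat \<Rightarrow> nat \<Rightarrow> (nat \<Rightarrow> nat \<Rightarrow> nat) set" where
  "perm_tuples K M = (\<Pi>\<^sub>E m\<in>{1..M}. perms K)"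

text \<open>The minimum over pairs \<open>k \<noteq> l\<close> being at least \<open>\<Delta>\<^sup>2\<close> is stated pair by pair.\<close>

definition Theta :: "nat \<Rightarrow> nat \<Rightarrow> real \<Rightarrow> real \<Rightarrow> (nat \<Rightarrow> nat \<Rightarrow> real) set" where
  "Theta K p \<sigma> \<Delta> =
    {\<mu> \<in> (\<Pi>\<^sub>E k\<in>{1..K}. \<Pi>\<^sub>E j\<in>{1..p}. UNIV).
      \<forall>k\<in>{1..K}. \<forall>l\<in>{1..K}. k \<noteq> l \<longrightarrow>
        (L2_set (\<lambda>j. \<mu> k j - \<mu> l j) {1..p})\<^sup>2 / (2 * \<sigma>\<^sup>2) \<ge> \<Delta>\<^sup>2}"

text \<open>\<open>\<N>(v, \<sigma>\<^sup>2 I\<^sub>p)\<close>; note that \<^const>\<open>normal_density\<close> takes the standard deviation.\<close>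

definition isotropic_normal :: "nat \<Rightarrow> (nat \<Rightarrow> real) \<Rightarrow> real \<Rightarrow> (nat \<Rightarrow> real) measure" where
  "isotropic_normal p v \<sigma> = (\<Pi>\<^sub>M j\<in>{1..p}. density lborel (normal_density (v j) \<sigma>))"

definition obs_space :: "nat \<Rightarrow> nat \<Rightarrow> nat \<Rightarrow> (nat \<times> nat \<Rightarrow> nat \<Rightarrow> real) measure" where
  "obs_space K M p = (\<Pi>\<^sub>M km\<in>{1..K} \<times> {1..M}. \<Pi>\<^sub>M j\<in>{1..p}. borel)"

definition obs_dist ::
  "nat \<Rightarrow> nat \<Rightarrow> nat \<Rightarrow> real \<Rightarrow> (nat \<Rightarrow> nat \<Rightarrow> real) \<Rightarrow> (nat \<Rightarrow> nat \<Rightarrow> nat)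
    \<Rightarrow> (nat \<times> nat \<Rightarrow> nat \<Rightarrow> real) measure" where
  "obs_dist K M p \<sigma> \<mu> \<pi> =
    (\<Pi>\<^sub>M (k, m)\<in>{1..K} \<times> {1..M}. isotropic_normal p (\<mu> (\<pi> m k)) \<sigma>)"

definition estimators ::
  "nat \<Rightarrow> nat \<Rightarrow> nat \<Rightarrow> ((nat \<times> nat \<Rightarrow> nat \<Rightarrow> real) \<Rightarrow> (nat \<Rightarrow> nat \<Rightarrow> nat)) set" where
  "estimators K M p = obs_space K M p \<rightarrow>\<^sub>M count_space (perm_tuples K M)"

definition err :: "nat \<Rightarrow> nat \<Rightarrow> (nat \<Rightarrow> nat \<Rightarrow> nat) \<Rightarrow> (nat \<Rightarrow> nat \<Rightarrow> nat) \<Rightarrow> real" where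
  "err K M \<pi> \<pi>' =
    (MIN \<psi>\<in>perms K.
      1 / (real K * real M) *
        (\<Sum>k\<in>{1..K}. \<Sum>m\<in>{1..M}. of_bool (\<psi> (\<pi> m k) \<noteq> \<pi>' m k)))"

text \<open>
  The risks take values in \<^typ>\<open>ennreal\<close>, a complete lattice, so that the infima and suprema
  are meaningful without side conditions.
\<close>

definition minimax_perfect :: "nat \<Rightarrow> nat \<Rightarrow> nat \<Rightarrow> real \<Rightarrow> real \<Rightarrow> ennreal" where
  "minimax_perfect K M p \<sigma> \<Delta> =
    (INF est\<in>estimators K M p. SUP \<mu>\<in>Theta K p \<sigma> \<Delta>. SUP \<pi>\<in>perm_tuples K M.
      emeasure (obs_dist K M p \<sigma> \<mu> \<pi>)
        {y \<in> space (obs_dist K M p \<sigma> \<mu> \<pi>). err K M (est y) \<pi> \<noteq> 0})"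

definition minimax_partial :: "nat \<Rightarrow> nat \<Rightarrow> nat \<Rightarrow> real \<Rightarrow> real \<Rightarrow> ennreal" where
  "minimax_partial K M p \<sigma> \<Delta> =
    (INF est\<in>estimators K M p. SUP \<mu>\<in>Theta K p \<sigma> \<Delta>. SUP \<pi>\<in>perm_tuples K M.
      \<integral>\<^sup>+ y. ennreal (err K M (est y) \<pi>) \<partial>obs_dist K M p \<sigma> \<mu> \<pi>)"

end

theory Submission imports Defs begin

text \<open>
  Both bounds are Bayesian: if a likelihood ratio has second moment at most \<open>B\<close> against a common
  reference measure \<open>Q\<close>, and at most \<open>V\<close> of the \<open>N\<close> hypotheses can be accepted at any observation,
  then the average success probability is at most \<open>\<surd>(B V / N)\<close>.

  For partial recovery, \<open>\<mu>\<close> is a random matrix of signs, scaled so that two independent rows typically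
  differ enough, and \<open>Q\<close> is pure noise.  Every permutation tuple is a hypothesis.  The second moment
  is of the order \<open>cosh (M a\<^sup>2 / \<sigma>\<^sup>2) ^ (K p)\<close>, and \<open>cosh x \<le> exp (min x (x\<^sup>2 / 2))\<close> accounts for the two
  terms of the threshold.

  For perfect recovery, the means come in pairs \<open>center \<plusminus> \<delta>\<close>, with far apart centers and random signs
  in \<open>\<delta>\<close>; a hypothesis swaps one pair in one sample, and \<open>Q\<close> is the unswapped mixture.  In one
  coordinate the likelihood ratio is \<open>cosh (Z - W) / cosh Z\<close>, where \<open>Z\<close> is linear in all the samples
  and \<open>W\<close> in the swapped one.
\<close>

subsection \<open>Tilting arrays of independent normal vectors\<close>

text \<open>The number of hypotheses dictates the reference measure. For partial recovery there are
  \<open>fact K ^ M\<close> of them, so a second moment exponential in \<open>K * M * ln K\<close>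
  is affordable, and pure noise will do. For perfect recovery there are only
  \<open>(M - 1) * (K div 2)\<close>, so the second moment has to stay below the order of
  \<open>K * M\<close>; against pure noise every pair would contribute to it. With the unswapped
  mixture as reference, all coordinates cancel except the \<open>p\<close> coordinates of the
  swapped pair. The price is the denominator \<open>cosh Z\<close>: the square
  \<open>cosh (Z - W) ^ 2 / cosh Z\<close> is not a sum of exponentials of linear forms, the only
  functions integrated here exactly. It is therefore bounded by such sums, in two ways. One gives an
  exponent linear in the squared separation, the other a quadratic one with a factor
  \<open>M\<close>; they serve the two terms of the threshold. The common relabelling in
  \<open>err\<close> costs one sample in both cases: a factor \<open>fact K\<close> in the count of
  accepted tuples, or a first permutation that is kept equal to the identity. This is where
  \<open>M \<ge> 2\<close> enters.\<close>

lemma PiM_density: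
  fixes f :: "'i \<Rightarrow> 'a \<Rightarrow> ennreal"
  assumes fin: "finite I" and N: "\<And>i. prob_space (N i)"
    and f[measurable]: "\<And>i. f i \<in> borel_measurable (N i)"
    and D: "\<And>i. prob_space (density (N i) (f i))"
  shows "PiM I (\<lambda>i. density (N i) (f i)) = density (PiM I N) (\<lambda>x. \<Prod>i\<in>I. f i (x i))"
proof -
  interpret N: product_sigma_finite N
    unfolding product_sigma_finite_def using N prob_space_imp_sigma_finite by blast
  interpret D: product_sigma_finite "\<lambda>i. density (N i) (f i)"
    unfolding product_sigma_finite_def using D prob_space_imp_sigma_finite by blast
  show ?thesis
  \<comment> \<open>It suffices to compare the two measures on boxes, where both the density and the
    indicator factor over the coordinates.\<close>
  proof (rule D.PiM_eqI[symmetric, OF fin])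
    show "sets (density (PiM I N) (\<lambda>x. \<Prod>i\<in>I. f i (x i))) = sets (PiM I (\<lambda>i. density (N i) (f i)))"
      by (auto intro!: sets_PiM_cong)
    fix A assume "\<And>i. i \<in> I \<Longrightarrow> A i \<in> sets (density (N i) (f i))"
    then have A[measurable]: "\<And>i. i \<in> I \<Longrightarrow> A i \<in> sets (N i)" by simp
    have "emeasure (density (PiM I N) (\<lambda>x. \<Prod>i\<in>I. f i (x i))) (Pi\<^sub>E I A)
        = (\<integral>\<^sup>+ x. (\<Prod>i\<in>I. f i (x i)) * indicator (Pi\<^sub>E I A) x \<partial>PiM I N)"
      by (rule emeasure_density) (auto intro!: sets_PiM_I_finite fin)
    also have "\<dots> = (\<integral>\<^sup>+ x. (\<Prod>i\<in>I. f i (x i) * indicator (A i) (x i)) \<partial>PiM I N)"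
    proof (rule nn_integral_cong)
      fix x assume "x \<in> space (PiM I N)"
      then have "x \<in> extensional I" by (simp add: space_PiM PiE_def)
      then have "indicator (Pi\<^sub>E I A) x = (\<Prod>i\<in>I. indicator (A i) (x i) :: ennreal)"
        using fin by (auto simp: indicator_def PiE_def Pi_def prod_zero_iff split: if_splits)
      then show "(\<Prod>i\<in>I. f i (x i)) * indicator (Pi\<^sub>E I A) x = (\<Prod>i\<in>I. f i (x i) * indicator (A i) (x i))"
        by (simp add: prod.distrib)
    qed
    also have "\<dots> = (\<Prod>i\<in>I. \<integral>\<^sup>+ x. f i x * indicator (A i) x \<partial>N i)"
      by (rule N.product_nn_integral_prod[OF fin]) simp
    also have "\<dots> = (\<Prod>i\<in>I. emeasure (density (N i) (f i)) (A i))"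
      by (intro prod.cong refl emeasure_density[symmetric]) auto
    finally show "emeasure (density (PiM I N) (\<lambda>x. \<Prod>i\<in>I. f i (x i))) (Pi\<^sub>E I A)
      = (\<Prod>i\<in>I. emeasure (density (N i) (f i)) (A i))" .
  qed
qed

definition normal_array :: "'i set \<Rightarrow> nat \<Rightarrow> ('i \<Rightarrow> nat \<Rightarrow> real) \<Rightarrow> real \<Rightarrow> ('i \<Rightarrow> nat \<Rightarrow> real) measure" where
  "normal_array I p m \<sigma> = (\<Pi>\<^sub>M i\<in>I. isotropic_normal p (m i) \<sigma>)"

lemma prob_space_isotropic_normal:
  assumes "\<sigma> > 0" shows "prob_space (isotropic_normal p v \<sigma>)"
  unfolding isotropic_normal_def using assms by (intro prob_space_PiM prob_space_normal_density)

lemma sets_isotropic_normal[measurable_cong]: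
  "sets (isotropic_normal p v \<sigma>) = sets (\<Pi>\<^sub>M j\<in>{1..p}. borel)"
  unfolding isotropic_normal_def by (auto intro!: sets_PiM_cong)

lemma prob_space_normal_array:
  assumes "\<sigma> > 0" shows "prob_space (normal_array I p m \<sigma>)"
  unfolding normal_array_def using assms by (intro prob_space_PiM prob_space_isotropic_normal)

lemma sets_normal_array[measurable_cong]:
  "sets (normal_array I p m \<sigma>) = sets (\<Pi>\<^sub>M i\<in>I. \<Pi>\<^sub>M j\<in>{1..p}. borel)"
  unfolding normal_array_def by (intro sets_PiM_cong refl sets_isotropic_normal)

lemma normal_density_tilt:
  assumes "\<sigma> > 0"
  shows "normal_density (v + \<sigma>\<^sup>2 * b) \<sigma> x
    = normal_density v \<sigma> x * exp (b * (x - v) - \<sigma>\<^sup>2 / 2 * b\<^sup>2)"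
proof -
  have "- (x - (v + \<sigma>\<^sup>2 * b))\<^sup>2 / (2 * \<sigma>\<^sup>2) = - (x - v)\<^sup>2 / (2 * \<sigma>\<^sup>2) + (b * (x - v) - \<sigma>\<^sup>2 / 2 * b\<^sup>2)"
    using assms by (simp add: field_simps power2_eq_square)
  then show ?thesis
    unfolding normal_density_def by (simp only: exp_add mult.assoc)
qed

lemma isotropic_normal_tilt:
  assumes "\<sigma> > 0"
  shows "isotropic_normal p (\<lambda>j. v j + \<sigma>\<^sup>2 * b j) \<sigma> = density (isotropic_normal p v \<sigma>)
    (\<lambda>x. ennreal (exp ((\<Sum>j\<in>{1..p}. b j * (x j - v j)) - \<sigma>\<^sup>2 / 2 * (\<Sum>j\<in>{1..p}. (b j)\<^sup>2))))"
proof -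
  let ?f = "\<lambda>j x. ennreal (exp (b j * (x - v j) - \<sigma>\<^sup>2 / 2 * (b j)\<^sup>2))"
  have eq: "density (density lborel (normal_density (v j) \<sigma>)) (?f j)
      = density lborel (normal_density (v j + \<sigma>\<^sup>2 * b j) \<sigma>)" for j
    by (subst density_density_eq) (auto simp: normal_density_tilt[OF assms] ennreal_mult intro!: density_cong)
  have "isotropic_normal p (\<lambda>j. v j + \<sigma>\<^sup>2 * b j) \<sigma>
      = PiM {1..p} (\<lambda>j. density (density lborel (normal_density (v j) \<sigma>)) (?f j))"
    unfolding isotropic_normal_def eq ..
  also have "\<dots> = density (isotropic_normal p v \<sigma>) (\<lambda>x. \<Prod>j\<in>{1..p}. ?f j (x j))"
    unfolding isotropic_normal_def
  proof (rule PiM_density)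
    show "prob_space (density (density lborel (normal_density (v j) \<sigma>)) (?f j))" for j
      unfolding eq by (intro prob_space_normal_density assms)
  qed (auto intro!: prob_space_normal_density assms)
  also have "(\<lambda>x. \<Prod>j\<in>{1..p}. ?f j (x j)) = (\<lambda>x. ennreal (exp ((\<Sum>j\<in>{1..p}. b j * (x j - v j)) - \<sigma>\<^sup>2 / 2 * (\<Sum>j\<in>{1..p}. (b j)\<^sup>2))))"
    by (subst prod_ennreal) (auto simp: exp_sum[symmetric] sum_subtractf sum_distrib_left)
  finally show ?thesis .
qed

text \<open>The Cameron-Martin factor without its normalising constant. Left unnormalised, products
  of tilts are again tilts, along the sum of the directions.\<close>

definition tilt :: "'i set \<Rightarrow> nat \<Rightarrow> ('i \<Rightarrow> nat \<Rightarrow> real) \<Rightarrow> ('i \<Rightarrow> nat \<Rightarrow> real) \<Rightarrow> ('i \<Rightarrow> nat \<Rightarrow> real) \<Rightarrow> real" where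
  "tilt I p \<nu> b y = exp (\<Sum>i\<in>I. \<Sum>j\<in>{1..p}. b i j * (y i j - \<nu> i j))"

lemma tilt_pos: "tilt I p \<nu> b y > 0"
  by (simp add: tilt_def)

lemma tilt_measurable[measurable]:
  "tilt I p \<nu> b \<in> borel_measurable (normal_array I p m \<sigma>)"
proof -
  have [measurable]: "(\<lambda>y. y i j) \<in> borel_measurable (normal_array I p m \<sigma>)"
    if "i \<in> I" "j \<in> {1..p}" for i j
  proof -
    have "(\<lambda>y. y i) \<in> measurable (normal_array I p m \<sigma>) (\<Pi>\<^sub>M j\<in>{1..p}. borel)"
      using that by measurable
    moreover have "(\<lambda>v. v j) \<in> borel_measurable (\<Pi>\<^sub>M j\<in>{1..p}. borel)" using that by measurable
    ultimately show ?thesis by (rule measurable_compose)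
  qed
  show ?thesis unfolding tilt_def by measurable
qed

lemma normal_array_tilt:
  assumes "\<sigma> > 0" and fin: "finite I"
  shows "normal_array I p (\<lambda>i j. \<nu> i j + \<sigma>\<^sup>2 * b i j) \<sigma> = density (normal_array I p \<nu> \<sigma>)
    (\<lambda>y. ennreal (exp (- (\<sigma>\<^sup>2 / 2) * (\<Sum>i\<in>I. \<Sum>j\<in>{1..p}. (b i j)\<^sup>2)) * tilt I p \<nu> b y))"
proof -
  let ?f = "\<lambda>i x. ennreal (exp ((\<Sum>j\<in>{1..p}. b i j * (x j - \<nu> i j)) - \<sigma>\<^sup>2 / 2 * (\<Sum>j\<in>{1..p}. (b i j)\<^sup>2)))"
  have "normal_array I p (\<lambda>i j. \<nu> i j + \<sigma>\<^sup>2 * b i j) \<sigma>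
     = PiM I (\<lambda>i. density (isotropic_normal p (\<nu> i) \<sigma>) (?f i))"
    unfolding normal_array_def isotropic_normal_tilt[OF assms(1)] ..
  also have "\<dots> = density (normal_array I p \<nu> \<sigma>) (\<lambda>y. \<Prod>i\<in>I. ?f i (y i))"
    unfolding normal_array_def
  proof (rule PiM_density[OF fin])
    show "prob_space (density (isotropic_normal p (\<nu> i) \<sigma>) (?f i))" for i
      unfolding isotropic_normal_tilt[OF assms(1), symmetric]
      by (intro prob_space_isotropic_normal assms)
  qed (auto intro!: prob_space_isotropic_normal assms)
  also have "(\<lambda>y. \<Prod>i\<in>I. ?f i (y i))
     = (\<lambda>y. ennreal (exp (- (\<sigma>\<^sup>2 / 2) * (\<Sum>i\<in>I. \<Sum>j\<in>{1..p}. (b i j)\<^sup>2)) * tilt I p \<nu> b y))"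
    unfolding tilt_def
    by (subst prod_ennreal)
       (auto simp: exp_sum[OF fin, symmetric] exp_add[symmetric] sum_subtractf sum_distrib_left sum_negf)
  finally show ?thesis .
qed

text \<open>The normal moment generating function, obtained without computing an integral: after
  normalisation the tilt is the density of a shifted normal array, so its total mass is one.\<close>

lemma integral_tilt:
  assumes "\<sigma> > 0" and "finite I"
  shows "has_bochner_integral (normal_array I p \<nu> \<sigma>) (tilt I p \<nu> b)
    (exp (\<sigma>\<^sup>2 / 2 * (\<Sum>i\<in>I. \<Sum>j\<in>{1..p}. (b i j)\<^sup>2)))"
proof (rule has_bochner_integral_nn_integral)
  let ?s = "\<sigma>\<^sup>2 / 2 * (\<Sum>i\<in>I. \<Sum>j\<in>{1..p}. (b i j)\<^sup>2)" and ?N = "normal_array I p \<nu> \<sigma>"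
  have "1 = emeasure (density ?N (\<lambda>y. ennreal (exp (- ?s) * tilt I p \<nu> b y))) (space ?N)"
    using prob_space.emeasure_space_1[OF prob_space_normal_array[OF assms(1), of I p "\<lambda>i j. \<nu> i j + \<sigma>\<^sup>2 * b i j"]]
    unfolding normal_array_tilt[OF assms] by simp
  also have "\<dots> = (\<integral>\<^sup>+ y. ennreal (exp (- ?s) * tilt I p \<nu> b y) \<partial>?N)"
    by (subst emeasure_density) (auto intro!: nn_integral_cong)
  also have "\<dots> = ennreal (exp (- ?s)) * (\<integral>\<^sup>+ y. ennreal (tilt I p \<nu> b y) \<partial>?N)"
    by (subst nn_integral_cmult[symmetric]) (auto simp: ennreal_mult less_imp_le[OF tilt_pos])
  finally have "ennreal (exp ?s) * 1 = ennreal (exp ?s) * (ennreal (exp (- ?s)) * (\<integral>\<^sup>+ y. ennreal (tilt I p \<nu> b y) \<partial>?N))"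
    by simp
  then show "(\<integral>\<^sup>+ y. ennreal (tilt I p \<nu> b y) \<partial>?N) = ennreal (exp ?s)"
    by (simp add: mult.assoc[symmetric] ennreal_mult[symmetric] exp_add[symmetric])
next
  show "AE y in normal_array I p \<nu> \<sigma>. 0 \<le> tilt I p \<nu> b y" by (simp add: less_imp_le[OF tilt_pos])
qed (rule tilt_measurable, simp)

subsection \<open>A second-moment form of Fano's inequality\<close>

lemma exists_le_average_ennreal:
  fixes g :: "'a \<Rightarrow> ennreal"
  assumes "finite A" "A \<noteq> {}" "sum g A \<le> ennreal (real (card A) * c)" "c \<ge> 0"
  shows "\<exists>a\<in>A. g a \<le> ennreal c"
proof (rule ccontr)
  assume "\<not> ?thesis"
  then have gt: "ennreal c < g a" if "a \<in> A" for a using that by auto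
  define x where "x = Min (g ` A)"
  have "x \<in> g ` A" unfolding x_def using assms by (intro Min_in) auto
  then have "ennreal c < x" using gt by auto
  have "of_nat (card A) * x \<le> sum g A"
    unfolding x_def using assms by (intro sum_bounded_below) auto
  also have "\<dots> \<le> of_nat (card A) * ennreal c"
    using assms by (simp add: ennreal_mult ennreal_of_nat_eq_real_of_nat)
  finally have "x \<le> ennreal c"
    using assms by (subst (asm) ennreal_mult_le_mult_iff) (auto simp: card_eq_0_iff)
  then show False using \<open>ennreal c < x\<close> by simp
qed

text \<open>Here \<open>j\<close> is the hypothesis, \<open>e\<close> a nuisance parameter averaged
  uniformly over \<open>G\<close>, and \<open>S j\<close> the event that \<open>j\<close> is
  accepted. The function \<open>r j\<close> bounds the squared mixture density divided by
  \<open>q\<close>; the condition is multiplied out, so that \<open>q\<close> may vanish and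
  \<open>r j\<close> may be any convenient majorant.\<close>

lemma chi_square_fano:
  fixes f :: "'j \<Rightarrow> 'e \<Rightarrow> 'a \<Rightarrow> real"
  assumes J: "finite J" "J \<noteq> {}" and G: "finite G" "G \<noteq> {}"
    and f[measurable]: "\<And>j e. f j e \<in> borel_measurable M" and f0: "\<And>j e y. f j e y \<ge> 0"
    and q[measurable]: "q \<in> borel_measurable M" and q0: "\<And>y. q y \<ge> 0"
    and r[measurable]: "\<And>j. r j \<in> borel_measurable M" and r0: "\<And>j y. r j y \<ge> 0"
    and S[measurable]: "\<And>j. S j \<in> sets M"
    and qint: "(\<integral>\<^sup>+ y. ennreal (q y) \<partial>M) \<le> 1"
    and rint: "\<And>j. j \<in> J \<Longrightarrow> (\<integral>\<^sup>+ y. ennreal (r j y) \<partial>M) \<le> ennreal B"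
    and pr: "\<And>j y. j \<in> J \<Longrightarrow> ((\<Sum>e\<in>G. f j e y) / real (card G))\<^sup>2 \<le> r j y * q y"
    and V: "\<And>y. y \<in> space M \<Longrightarrow> real (card {j\<in>J. y \<in> S j}) \<le> V"
    and B: "B > 0" "4 * V * B \<le> real (card J)"
  shows "\<exists>j\<in>J. \<exists>e\<in>G. emeasure (density M (f j e)) (S j) \<le> ennreal (1/2)"
proof -
  have cG: "real (card G) > 0" using G by (simp add: card_gt_0_iff)
  \<comment> \<open>A weighted arithmetic-geometric mean inequality replaces Cauchy-Schwarz. With
    this weight, the terms in \<open>r\<close> and in \<open>q\<close> each contribute at most a
    quarter of \<open>card J * card G\<close>, the former by \<open>rint\<close> and the latter by
    \<open>4 * V * B \<le> card J\<close>.\<close>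
  have amgm: "(\<Sum>e\<in>G. f j e y) \<le> real (card G) * (r j y / (4 * B) + B * q y)" if "j \<in> J" for j y
  proof -
    let ?p = "(\<Sum>e\<in>G. f j e y) / real (card G)"
    have "?p\<^sup>2 \<le> r j y * q y" using pr that by simp
    also have "r j y * q y = (r j y / (4 * B) + B * q y)\<^sup>2 - (r j y / (4 * B) - B * q y)\<^sup>2"
      using B by (simp add: field_simps power2_eq_square)
    also have "\<dots> \<le> (r j y / (4 * B) + B * q y)\<^sup>2" by simp
    finally have "?p \<le> r j y / (4 * B) + B * q y"
      by (rule power2_le_imp_le) (use B r0 q0 in \<open>simp add: add_nonneg_nonneg\<close>)
    then show ?thesis using cG by (simp add: pos_divide_le_eq mult.commute)
  qed
  have "(\<Sum>j\<in>J. \<Sum>e\<in>G. emeasure (density M (f j e)) (S j))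
      = (\<integral>\<^sup>+ y. (\<Sum>j\<in>J. \<Sum>e\<in>G. ennreal (f j e y) * indicator (S j) y) \<partial>M)"
    by (simp add: emeasure_density nn_integral_sum)
  also have "\<dots> \<le> (\<integral>\<^sup>+ y. (\<Sum>j\<in>J. ennreal (real (card G) / (4 * B)) * ennreal (r j y))
      + ennreal (real (card G) * B * V) * ennreal (q y) \<partial>M)"
  proof (rule nn_integral_mono)
    fix y assume y: "y \<in> space M"
    have V0: "V \<ge> 0" using V[OF y] by (meson of_nat_0_le_iff order_trans)
    have "(\<Sum>j\<in>J. \<Sum>e\<in>G. ennreal (f j e y) * indicator (S j) y)
        = ennreal (\<Sum>j\<in>J. \<Sum>e\<in>G. f j e y * indicator (S j) y)"
      using f0 by (simp add: sum_ennreal[symmetric] sum_nonneg ennreal_mult ennreal_indicator)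
    also have "(\<Sum>j\<in>J. \<Sum>e\<in>G. f j e y * indicator (S j) y)
       \<le> (\<Sum>j\<in>J. real (card G) / (4 * B) * r j y + real (card G) * B * q y * indicator (S j) y)"
    proof (rule sum_mono)
      fix j assume j: "j \<in> J"
      show "(\<Sum>e\<in>G. f j e y * indicator (S j) y)
        \<le> real (card G) / (4 * B) * r j y + real (card G) * B * q y * indicator (S j) y"
        using amgm[OF j, of y] B r0[of j y]
        by (cases "y \<in> S j") (simp_all add: distrib_left mult.assoc)
    qed
    also have "\<dots> = (\<Sum>j\<in>J. real (card G) / (4 * B) * r j y)
        + real (card G) * B * q y * real (card {j\<in>J. y \<in> S j})"
      using J by (simp add: sum.distrib sum_distrib_left[symmetric] indicator_def sum.If_cases Int_def
         of_bool_def)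
    also have "\<dots> \<le> (\<Sum>j\<in>J. real (card G) / (4 * B) * r j y) + real (card G) * B * q y * V"
      using V[OF y] B q0[of y] by (intro add_left_mono mult_left_mono) auto
    also have "ennreal \<dots> = (\<Sum>j\<in>J. ennreal (real (card G) / (4 * B)) * ennreal (r j y))
      + ennreal (real (card G) * B * V) * ennreal (q y)"
      using B r0 q0 V0
      by (subst ennreal_plus) (auto simp: sum_nonneg ennreal_mult[symmetric] sum_ennreal ac_simps)
    finally show "(\<Sum>j\<in>J. \<Sum>e\<in>G. ennreal (f j e y) * indicator (S j) y) \<le> \<dots>"
      by (simp add: ennreal_leI)
  qed
  also have "\<dots> = (\<Sum>j\<in>J. ennreal (real (card G) / (4 * B)) * (\<integral>\<^sup>+ y. ennreal (r j y) \<partial>M))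
      + ennreal (real (card G) * B * V) * (\<integral>\<^sup>+ y. ennreal (q y) \<partial>M)"
    by (simp add: nn_integral_add nn_integral_sum nn_integral_cmult)
  also have "\<dots> \<le> (\<Sum>j\<in>J. ennreal (real (card G) / (4 * B)) * ennreal B) + ennreal (real (card G) * B * V) * 1"
    by (intro add_mono sum_mono mult_left_mono rint qint) auto
  also have "\<dots> = ennreal (real (card J) * (real (card G) / 4)) + ennreal (real (card G) * B * V)"
    using B by (simp add: ennreal_mult[symmetric] ennreal_of_nat_eq_real_of_nat)
  also have "\<dots> \<le> ennreal (real (card J) * (real (card G) / 4)) + ennreal (real (card J) * (real (card G) / 4))"
    using B cG by (intro add_left_mono ennreal_leI) (simp add: field_simps)
  also have "\<dots> = ennreal (real (card (J \<times> G)) * (1/2))"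
    by (subst ennreal_plus[symmetric]) (auto simp: card_cartesian_product)
  finally have "(\<Sum>x\<in>J \<times> G. emeasure (density M (f (fst x) (snd x))) (S (fst x))) \<le> ennreal (real (card (J \<times> G)) * (1/2))"
    by (simp add: sum.cartesian_product case_prod_beta)
  moreover have "J \<times> G \<noteq> {}" using J G by auto
  ultimately obtain x where "x \<in> J \<times> G" "emeasure (density M (f (fst x) (snd x))) (S (fst x)) \<le> ennreal (1/2)"
    using exists_le_average_ennreal[OF finite_cartesian_product[OF J(1) G(1)], of
      "\<lambda>x. emeasure (density M (f (fst x) (snd x))) (S (fst x))" "1/2"] by fastforce
  then show ?thesis by (intro bexI[of _ "fst x"] bexI[of _ "snd x"]) auto
qed

subsection \<open>Reduction of the minimax risks to one hard instance\<close>

lemma obs_dist_eq_normal_array: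
  "obs_dist K M p \<sigma> \<mu> \<pi> = normal_array ({1..K} \<times> {1..M}) p (\<lambda>(k, m). \<mu> (\<pi> m k)) \<sigma>"
  unfolding obs_dist_def normal_array_def by (simp add: case_prod_unfold)

lemma sets_obs_dist[measurable_cong]: "sets (obs_dist K M p \<sigma> \<mu> \<pi>) = sets (obs_space K M p)"
  unfolding obs_dist_eq_normal_array sets_normal_array obs_space_def ..

lemma space_obs_dist: "space (obs_dist K M p \<sigma> \<mu> \<pi>) = space (obs_space K M p)"
  by (rule sets_eq_imp_space_eq[OF sets_obs_dist])

lemma finite_perms: "finite (perms K)" and perms_nonempty: "perms K \<noteq> {}"
  unfolding perms_def using finite_permutations[of "{1..K}"] permutes_id[of "{1..K}"] by blast+

lemma finite_perm_tuples: "finite (perm_tuples K M)"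
  unfolding perm_tuples_def by (intro finite_PiE finite_perms) auto

lemma estimators_in_perm_tuples:
  "est \<in> estimators K M p \<Longrightarrow> y \<in> space (obs_space K M p) \<Longrightarrow> est y \<in> perm_tuples K M"
  unfolding estimators_def by (auto dest: measurable_space)

lemma estimators_event:
  assumes "est \<in> estimators K M p"
  shows "{y \<in> space (obs_space K M p). P (est y)} \<in> sets (obs_space K M p)"
proof -
  have "est -` {\<pi> \<in> perm_tuples K M. P \<pi>} \<inter> space (obs_space K M p) \<in> sets (obs_space K M p)"
    by (rule measurable_sets[OF assms[unfolded estimators_def]]) auto
  also have "est -` {\<pi> \<in> perm_tuples K M. P \<pi>} \<inter> space (obs_space K M p) = {y \<in> space (obs_space K M p). P (est y)}"
    using estimators_in_perm_tuples[OF assms] by auto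
  finally show ?thesis .
qed

lemma prob_complement_obs_dist:
  assumes "\<sigma> > 0" "est \<in> estimators K M p"
    and "emeasure (obs_dist K M p \<sigma> \<mu> \<pi>) {y \<in> space (obs_space K M p). P (est y)} \<le> ennreal (1/2)"
  shows "emeasure (obs_dist K M p \<sigma> \<mu> \<pi>) {y \<in> space (obs_space K M p). \<not> P (est y)} \<ge> ennreal (1/2)"
proof -
  interpret prob_space "obs_dist K M p \<sigma> \<mu> \<pi>"
    unfolding obs_dist_eq_normal_array by (rule prob_space_normal_array[OF assms(1)])
  let ?A = "{y \<in> space (obs_space K M p). P (est y)}"
  have eq: "{y \<in> space (obs_space K M p). \<not> P (est y)} = space (obs_dist K M p \<sigma> \<mu> \<pi>) - ?A"
    by (auto simp: space_obs_dist)
  have "prob ?A \<le> 1/2"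
    using assms(3) unfolding emeasure_eq_measure by (subst (asm) ennreal_le_iff) auto
  moreover have "prob (space (obs_dist K M p \<sigma> \<mu> \<pi>) - ?A) = 1 - prob ?A"
    by (rule prob_compl) (simp add: sets_obs_dist estimators_event[OF assms(2)])
  ultimately show ?thesis unfolding eq emeasure_eq_measure by (intro ennreal_leI) simp
qed

lemma minimax_perfectI:
  assumes "\<sigma> > 0"
    and "\<And>est. est \<in> estimators K M p \<Longrightarrow> \<exists>\<mu>\<in>Theta K p \<sigma> \<Delta>. \<exists>\<pi>\<in>perm_tuples K M.
      emeasure (obs_dist K M p \<sigma> \<mu> \<pi>) {y \<in> space (obs_space K M p). err K M (est y) \<pi> = 0} \<le> ennreal (1/2)"
  shows "minimax_perfect K M p \<sigma> \<Delta> \<ge> ennreal (1/2)"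
  unfolding minimax_perfect_def
proof (rule INF_greatest)
  fix est assume est: "est \<in> estimators K M p"
  from assms(2)[OF this] obtain \<mu> \<pi> where "\<mu> \<in> Theta K p \<sigma> \<Delta>" "\<pi> \<in> perm_tuples K M"
    "emeasure (obs_dist K M p \<sigma> \<mu> \<pi>) {y \<in> space (obs_space K M p). err K M (est y) \<pi> = 0} \<le> ennreal (1/2)" by blast
  with prob_complement_obs_dist[OF assms(1) est, of \<mu> \<pi> "\<lambda>x. err K M x \<pi> = 0"]
  show "ennreal (1/2) \<le> (SUP \<mu>\<in>Theta K p \<sigma> \<Delta>. SUP \<pi>\<in>perm_tuples K M.
      emeasure (obs_dist K M p \<sigma> \<mu> \<pi>) {y \<in> space (obs_dist K M p \<sigma> \<mu> \<pi>). err K M (est y) \<pi> \<noteq> 0})"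
    by (intro SUP_upper2) (auto simp: space_obs_dist)
qed

text \<open>Markov's inequality: the error exceeds \<open>c\<close> with probability at least one
  half, which makes its mean at least \<open>c / 2\<close>.\<close>

lemma minimax_partialI:
  assumes "\<sigma> > 0" "c \<ge> 0"
    and "\<And>est. est \<in> estimators K M p \<Longrightarrow> \<exists>\<mu>\<in>Theta K p \<sigma> \<Delta>. \<exists>\<pi>\<in>perm_tuples K M.
      emeasure (obs_dist K M p \<sigma> \<mu> \<pi>) {y \<in> space (obs_space K M p). err K M (est y) \<pi> \<le> c} \<le> ennreal (1/2)"
  shows "minimax_partial K M p \<sigma> \<Delta> \<ge> ennreal (c / 2)"
  unfolding minimax_partial_def
proof (rule INF_greatest)
  fix est assume est: "est \<in> estimators K M p"
  from assms(3)[OF this] obtain \<mu> \<pi> where *: "\<mu> \<in> Theta K p \<sigma> \<Delta>" "\<pi> \<in> perm_tuples K M"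
    "emeasure (obs_dist K M p \<sigma> \<mu> \<pi>) {y \<in> space (obs_space K M p). err K M (est y) \<pi> \<le> c} \<le> ennreal (1/2)" by blast
  let ?D = "obs_dist K M p \<sigma> \<mu> \<pi>" and ?A = "{y \<in> space (obs_space K M p). \<not> err K M (est y) \<pi> \<le> c}"
  have "ennreal (c * (1/2)) = ennreal c * ennreal (1/2)"
    using assms(2) by (intro ennreal_mult) auto
  then have "ennreal (c / 2) = ennreal c * ennreal (1/2)" by (simp only: times_divide_eq_right mult_1_right)
  also have "\<dots> \<le> ennreal c * emeasure ?D ?A"
    by (intro mult_left_mono prob_complement_obs_dist[OF assms(1) est] *) auto
  also have "\<dots> = (\<integral>\<^sup>+ y. ennreal c * indicator ?A y \<partial>?D)"
    by (intro nn_integral_cmult_indicator[symmetric])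
       (simp only: sets_obs_dist estimators_event[OF est, of "\<lambda>x. \<not> err K M x \<pi> \<le> c"])
  also have "\<dots> \<le> (\<integral>\<^sup>+ y. ennreal (err K M (est y) \<pi>) \<partial>?D)"
    by (intro nn_integral_mono) (auto simp: indicator_def intro!: ennreal_leI)
  finally show "ennreal (c / 2) \<le> (SUP \<mu>\<in>Theta K p \<sigma> \<Delta>. SUP \<pi>\<in>perm_tuples K M.
      \<integral>\<^sup>+ y. ennreal (err K M (est y) \<pi>) \<partial>obs_dist K M p \<sigma> \<mu> \<pi>)"
    using * by (intro SUP_upper2) auto
qed

lemma err_le_iff:
  "err K M \<pi> \<pi>' \<le> c \<longleftrightarrow> (\<exists>\<psi>\<in>perms K.
     1 / (real K * real M) * (\<Sum>k\<in>{1..K}. \<Sum>m\<in>{1..M}. of_bool (\<psi> (\<pi> m k) \<noteq> \<pi>' m k)) \<le> c)"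
  unfolding err_def using finite_perms perms_nonempty by (subst Min_le_iff) auto

lemma err_zeroE:
  assumes "err K M \<pi> \<pi>' = 0" "K > 0" "M > 0"
  obtains \<psi> where "\<psi> \<in> perms K" "\<And>k m. k \<in> {1..K} \<Longrightarrow> m \<in> {1..M} \<Longrightarrow> \<psi> (\<pi> m k) = \<pi>' m k"
proof -
  have "err K M \<pi> \<pi>' \<le> 0" using assms by simp
  then obtain \<psi> where \<psi>: "\<psi> \<in> perms K"
    "(\<Sum>k\<in>{1..K}. \<Sum>m\<in>{1..M}. of_bool (\<psi> (\<pi> m k) \<noteq> \<pi>' m k)) \<le> (0::real)"
    unfolding err_le_iff using assms by (auto simp: field_simps)
  then have eq0: "(\<Sum>k\<in>{1..K}. \<Sum>m\<in>{1..M}. of_bool (\<psi> (\<pi> m k) \<noteq> \<pi>' m k)) = (0::real)"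
    by (intro antisym sum_nonneg) auto
  have "\<psi> (\<pi> m k) = \<pi>' m k" if "k \<in> {1..K}" "m \<in> {1..M}" for k m
  proof -
    have "(\<Sum>m\<in>{1..M}. of_bool (\<psi> (\<pi> m k) \<noteq> \<pi>' m k)) = (0::real)"
      using eq0 that(1) by (subst (asm) sum_nonneg_eq_0_iff) (auto intro!: sum_nonneg)
    then have "of_bool (\<psi> (\<pi> m k) \<noteq> \<pi>' m k) = (0::real)"
      using that(2) by (subst (asm) sum_nonneg_eq_0_iff) auto
    then show ?thesis by simp
  qed
  with \<psi>(1) that show thesis by blast
qed

text \<open>Perfect recovery fixes the permutations up to one common relabelling, so it separates
  tuples that agree in their first permutation.\<close>

lemma err_zero_unique:
  assumes "\<pi> \<in> perm_tuples K M" and K: "K > 0" "M > 0"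
    and e1: "err K M \<pi> \<pi>' = 0" and e2: "err K M \<pi> \<pi>'' = 0"
    and id: "\<And>k. k \<in> {1..K} \<Longrightarrow> \<pi>' 1 k = k" "\<And>k. k \<in> {1..K} \<Longrightarrow> \<pi>'' 1 k = k"
    and km: "k \<in> {1..K}" "m \<in> {1..M}"
  shows "\<pi>' m k = \<pi>'' m k"
proof -
  obtain \<psi> where \<psi>: "\<And>k m. k \<in> {1..K} \<Longrightarrow> m \<in> {1..M} \<Longrightarrow> \<psi> (\<pi> m k) = \<pi>' m k"
    using err_zeroE[OF e1 K] by metis
  obtain \<phi> where \<phi>: "\<And>k m. k \<in> {1..K} \<Longrightarrow> m \<in> {1..M} \<Longrightarrow> \<phi> (\<pi> m k) = \<pi>'' m k"
    using err_zeroE[OF e2 K] by metis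
  have perm: "\<pi> m permutes {1..K}" if "m \<in> {1..M}" for m
    using assms(1) that by (auto simp: perm_tuples_def perms_def)
  have "\<pi> m k \<in> {1..K}" using permutes_in_image[OF perm[OF km(2)]] km(1) by simp
  \<comment> \<open>The value \<open>\<pi> m k\<close> is also taken by the first permutation, at
    some \<open>l\<close>. As both targets start with the identity, both relabellings must send this
    value to \<open>l\<close>, hence they agree on it.\<close>
  then have "\<pi> m k \<in> \<pi> 1 ` {1..K}" using perm[of 1] K by (simp add: permutes_image)
  then obtain l where l: "l \<in> {1..K}" "\<pi> 1 l = \<pi> m k" by auto
  have "\<psi> (\<pi> 1 l) = l" "\<phi> (\<pi> 1 l) = l"
    using \<psi>[of l 1] \<phi>[of l 1] l id K by auto
  then show ?thesis using \<psi>[OF km] \<phi>[OF km] l by simp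
qed

subsection \<open>Independence across cells\<close>

lemma sum_square_orthogonal:
  fixes x :: "'e \<Rightarrow> real"
  assumes "finite E" "\<And>e e'. e \<in> E \<Longrightarrow> e' \<in> E \<Longrightarrow> e \<noteq> e' \<Longrightarrow> x e * x e' = 0"
  shows "(\<Sum>e\<in>E. x e)\<^sup>2 = (\<Sum>e\<in>E. (x e)\<^sup>2)"
proof -
  have "(\<Sum>e'\<in>E. x e * x e') = (x e)\<^sup>2" if "e \<in> E" for e
  proof -
    have "(\<Sum>e'\<in>E. x e * x e') = (\<Sum>e'\<in>E. if e' = e then (x e)\<^sup>2 else 0)"
      using assms(2) that by (intro sum.cong) (auto simp: power2_eq_square)
    then show ?thesis using assms(1) that by simp
  qed
  then show ?thesis by (simp add: power2_eq_square sum_product)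
qed

lemma sum_square_orthogonal_array:
  fixes b :: "'e \<Rightarrow> 'i \<Rightarrow> 'j \<Rightarrow> real"
  assumes E: "finite E" and orth: "\<And>e e' i j. e \<noteq> e' \<Longrightarrow> b e i j * b e' i j = 0"
  shows "(\<Sum>i\<in>I. \<Sum>j\<in>J. (\<Sum>e\<in>E. b e i j)\<^sup>2) = (\<Sum>e\<in>E. \<Sum>i\<in>I. \<Sum>j\<in>J. (b e i j)\<^sup>2)"
proof -
  have "(\<Sum>i\<in>I. \<Sum>j\<in>J. (\<Sum>e\<in>E. b e i j)\<^sup>2) = (\<Sum>i\<in>I. \<Sum>j\<in>J. \<Sum>e\<in>E. (b e i j)\<^sup>2)"
    using orth by (intro sum.cong refl sum_square_orthogonal E) auto
  also have "\<dots> = (\<Sum>i\<in>I. \<Sum>e\<in>E. \<Sum>j\<in>J. (b e i j)\<^sup>2)"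
    by (intro sum.cong refl sum.swap)
  also have "\<dots> = (\<Sum>e\<in>E. \<Sum>i\<in>I. \<Sum>j\<in>J. (b e i j)\<^sup>2)" by (rule sum.swap)
  finally show ?thesis .
qed

lemma tilt_sum:
  assumes "finite E"
  shows "(\<Prod>e\<in>E. tilt I p \<nu> (b e) y) = tilt I p \<nu> (\<lambda>i j. \<Sum>e\<in>E. b e i j) y"
proof -
  have "(\<Sum>e\<in>E. \<Sum>i\<in>I. \<Sum>j\<in>{1..p}. b e i j * (y i j - \<nu> i j))
      = (\<Sum>i\<in>I. \<Sum>e\<in>E. \<Sum>j\<in>{1..p}. b e i j * (y i j - \<nu> i j))"
    by (rule sum.swap)
  also have "\<dots> = (\<Sum>i\<in>I. \<Sum>j\<in>{1..p}. \<Sum>e\<in>E. b e i j * (y i j - \<nu> i j))"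
    by (intro sum.cong refl sum.swap)
  finally show ?thesis
    unfolding tilt_def exp_sum[OF assms, symmetric] by (simp add: sum_distrib_right)
qed

lemma integral_prod_tilt:
  fixes c :: "'e \<Rightarrow> 't \<Rightarrow> real" and b :: "'e \<Rightarrow> 't \<Rightarrow> 'i \<Rightarrow> nat \<Rightarrow> real"
  assumes \<sigma>: "\<sigma> > 0" and I: "finite I" and E: "finite E" and T: "finite T"
    and orth: "\<And>e e' t t' i j. e \<noteq> e' \<Longrightarrow> b e t i j * b e' t' i j = 0"
  shows "has_bochner_integral (normal_array I p \<nu> \<sigma>)
    (\<lambda>y. \<Prod>e\<in>E. \<Sum>t\<in>T. c e t * tilt I p \<nu> (b e t) y)
    (\<Prod>e\<in>E. \<Sum>t\<in>T. c e t * exp (\<sigma>\<^sup>2 / 2 * (\<Sum>i\<in>I. \<Sum>j\<in>{1..p}. (b e t i j)\<^sup>2)))"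
proof -
  let ?F = "\<lambda>\<tau> i j. \<Sum>e\<in>E. b e (\<tau> e) i j"
  have sq: "(\<Sum>i\<in>I. \<Sum>j\<in>{1..p}. (?F \<tau> i j)\<^sup>2) = (\<Sum>e\<in>E. \<Sum>i\<in>I. \<Sum>j\<in>{1..p}. (b e (\<tau> e) i j)\<^sup>2)" for \<tau>
    using orth by (intro sum_square_orthogonal_array E)
  have "has_bochner_integral (normal_array I p \<nu> \<sigma>)
     (\<lambda>y. \<Sum>\<tau>\<in>E \<rightarrow>\<^sub>E T. (\<Prod>e\<in>E. c e (\<tau> e)) * tilt I p \<nu> (?F \<tau>) y)
     (\<Sum>\<tau>\<in>E \<rightarrow>\<^sub>E T. (\<Prod>e\<in>E. c e (\<tau> e)) * exp (\<sigma>\<^sup>2 / 2 * (\<Sum>i\<in>I. \<Sum>j\<in>{1..p}. (?F \<tau> i j)\<^sup>2)))"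
    by (intro has_bochner_integral_sum has_bochner_integral_mult_right integral_tilt \<sigma> I)
  moreover have "(\<Sum>\<tau>\<in>E \<rightarrow>\<^sub>E T. (\<Prod>e\<in>E. c e (\<tau> e)) * tilt I p \<nu> (?F \<tau>) y)
      = (\<Prod>e\<in>E. \<Sum>t\<in>T. c e t * tilt I p \<nu> (b e t) y)" for y
    by (subst prod_sum_PiE) (auto simp: E T prod.distrib tilt_sum)
  moreover have "(\<Sum>\<tau>\<in>E \<rightarrow>\<^sub>E T. (\<Prod>e\<in>E. c e (\<tau> e)) * exp (\<sigma>\<^sup>2 / 2 * (\<Sum>i\<in>I. \<Sum>j\<in>{1..p}. (?F \<tau> i j)\<^sup>2)))
      = (\<Prod>e\<in>E. \<Sum>t\<in>T. c e t * exp (\<sigma>\<^sup>2 / 2 * (\<Sum>i\<in>I. \<Sum>j\<in>{1..p}. (b e t i j)\<^sup>2)))"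
    unfolding sq
    by (subst prod_sum_PiE) (auto simp: E T prod.distrib exp_sum[OF E, symmetric] sum_distrib_left intro!: sum.cong)
  ultimately show ?thesis by simp
qed

subsection \<open>Sign matrices\<close>

lemma tanh_le_self:
  fixes x :: real assumes "x \<ge> 0" shows "tanh x \<le> x"
proof -
  have "0 - tanh 0 \<le> x - tanh x"
    by (rule DERIV_nonneg_imp_nondecreasing[OF assms])
       (auto intro!: exI derivative_eq_intros)
  then show ?thesis by simp
qed

text \<open>By symmetry only \<open>x \<ge> 0\<close> matters; there the difference of the
  logarithms has derivative \<open>z - tanh z\<close>, which is nonnegative.\<close>

lemma cosh_le_exp_square:
  fixes x :: real shows "cosh x \<le> exp (x\<^sup>2 / 2)"
proof -
  have *: "cosh x \<le> exp (x\<^sup>2 / 2)" if "x \<ge> 0" for x :: real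
  proof -
    have "0\<^sup>2 / 2 - ln (cosh 0) \<le> x\<^sup>2 / 2 - ln (cosh x)"
    proof (rule DERIV_nonneg_imp_nondecreasing[OF that])
      fix z :: real assume "0 \<le> z"
      then show "\<exists>D. ((\<lambda>x. x\<^sup>2 / 2 - ln (cosh x)) has_real_derivative D) (at z) \<and> 0 \<le> D"
        using tanh_le_self[of z]
        by (intro exI[of _ "z - tanh z"]) (auto intro!: derivative_eq_intros simp: tanh_def field_simps)
    qed
    then have "ln (cosh x) \<le> x\<^sup>2 / 2" by simp
    then show ?thesis by (metis cosh_real_pos exp_le_cancel_iff exp_ln)
  qed
  show ?thesis using *[of x] *[of "- x"] by (cases "x \<ge> 0") auto
qed

lemma cosh_le_exp:
  fixes x :: real assumes "x \<ge> 0" shows "cosh x \<le> exp x"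
  using assms by (simp add: cosh_field_def)

text \<open>The quotient \<open>K ^ K / fact K\<close> is a single term of the series of
  \<open>exp K\<close>. The remaining loss \<open>K\<close> is absorbed by half of
  \<open>K * ln K\<close>, as \<open>ln K \<ge> 2\<close>.\<close>

lemma exp_le_fact:
  assumes "K \<ge> 1" "ln (real K) \<ge> 2"
  shows "exp (real K * ln (real K) / 2) \<le> fact K"
proof -
  have "real K ^ K / fact K \<le> exp (real K)"
  proof -
    have "sum (\<lambda>n. real K ^ n /\<^sub>R fact n) {K} \<le> (\<Sum>n. real K ^ n /\<^sub>R fact n)"
      by (rule sum_le_suminf) (auto simp: divide_inverse mult.commute intro!: summable_exp)
    then show ?thesis by (simp add: exp_def divide_inverse mult.commute)
  qed
  then have "exp (real K * ln (real K) - real K) \<le> fact K"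
    using assms by (simp add: exp_diff field_simps exp_of_nat_mult flip: powr_realpow)
  moreover have "real K * ln (real K) / 2 \<le> real K * ln (real K) - real K"
    using assms(2) mult_left_mono[OF assms(2), of "real K"] by simp
  ultimately show ?thesis by (meson exp_le_cancel_iff order_trans)
qed

section \<open>Exponential moments of random signs\<close>

lemma rademacher_mgf:
  fixes E :: "'e set"
  assumes "finite E" "\<And>e. e \<in> E \<Longrightarrow> \<epsilon>' e \<in> {-1, 1::real}"
  shows "(\<Sum>\<epsilon>\<in>E \<rightarrow>\<^sub>E {-1, 1}. exp (x * (\<Sum>e\<in>E. \<epsilon> e * \<epsilon>' e))) = (2 * cosh x) ^ card E"
proof -
  have "(\<Sum>\<epsilon>\<in>E \<rightarrow>\<^sub>E {-1, 1}. exp (x * (\<Sum>e\<in>E. \<epsilon> e * \<epsilon>' e)))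
      = (\<Sum>\<epsilon>\<in>E \<rightarrow>\<^sub>E {-1, 1}. \<Prod>e\<in>E. exp (x * (\<epsilon> e * \<epsilon>' e)))"
    by (simp add: sum_distrib_left exp_sum[OF assms(1)])
  also have "\<dots> = (\<Prod>e\<in>E. \<Sum>t\<in>{-1, 1}. exp (x * (t * \<epsilon>' e)))"
    by (rule prod_sum_PiE[symmetric]) (auto simp: assms)
  also have "\<dots> = (\<Prod>e\<in>E. 2 * cosh x)"
    using assms(2) by (intro prod.cong refl) (force simp: cosh_field_def)
  finally show ?thesis by simp
qed

lemma card_signs: "finite E \<Longrightarrow> card (E \<rightarrow>\<^sub>E {-1, 1::real}) = 2 ^ card E"
  by (simp add: card_PiE card_insert_if numeral_2_eq_2)

lemma finite_signs: "finite E \<Longrightarrow> finite (E \<rightarrow>\<^sub>E {-1, 1::real})"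
  by (simp add: finite_PiE)

text \<open>Multiplying row \<open>k\<close> by row \<open>l\<close> is an involution of the sign matrices; it turns the inner
  product of the two rows into a sum of independent signs.\<close>

lemma sum_exp_row_product:
  fixes K p :: nat
  assumes kl: "k \<in> {1..K}" "l \<in> {1..K}" "k \<noteq> l"
  defines "E \<equiv> {1..K} \<times> {1..p}"
  shows "(\<Sum>\<epsilon>\<in>E \<rightarrow>\<^sub>E {-1, 1::real}. exp (x * (\<Sum>j\<in>{1..p}. \<epsilon> (k, j) * \<epsilon> (l, j))))
    = 2 ^ card E * cosh x ^ p"
proof -
  let ?\<Omega> = "E \<rightarrow>\<^sub>E {-1, 1::real}"
  define \<phi> where "\<phi> \<epsilon> = (\<lambda>(i, j)\<in>E. if i = k then \<epsilon> (k, j) * \<epsilon> (l, j) else \<epsilon> (i, j))" for \<epsilon> :: "nat \<times> nat \<Rightarrow> real"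
  have finE: "finite E" by (simp add: E_def)
  have sq: "\<epsilon> e * \<epsilon> e = 1" if "\<epsilon> \<in> ?\<Omega>" "e \<in> E" for \<epsilon> e
    using that by (force simp: PiE_iff)
  have \<phi>_in: "\<phi> \<epsilon> \<in> ?\<Omega>" if "\<epsilon> \<in> ?\<Omega>" for \<epsilon>
  proof (rule PiE_I)
    fix e assume "e \<in> E"
    moreover have "(l, snd e) \<in> E" using \<open>e \<in> E\<close> kl by (auto simp: E_def)
    ultimately have "\<epsilon> e \<in> {-1, 1}" "\<epsilon> (l, snd e) \<in> {-1, 1}" using PiE_mem[OF that] by blast+
    then show "\<phi> \<epsilon> e \<in> {-1, 1}" using \<open>e \<in> E\<close> by (cases e) (auto simp: \<phi>_def)
  qed (auto simp: \<phi>_def)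
  have \<phi>_inv: "\<phi> (\<phi> \<epsilon>) = \<epsilon>" if "\<epsilon> \<in> ?\<Omega>" for \<epsilon>
  proof
    fix e show "\<phi> (\<phi> \<epsilon>) e = \<epsilon> e"
    proof (cases "e \<in> E")
      case True
      obtain i j where e: "e = (i, j)" by force
      have "(l, j) \<in> E" using True kl by (auto simp: E_def e)
      with True sq[OF that this] kl(3) show ?thesis
        by (auto simp: \<phi>_def e mult.assoc)
    next
      case False
      then show ?thesis using PiE_arb[OF that False] by (cases e) (auto simp: \<phi>_def)
    qed
  qed
  have "(\<Sum>\<epsilon>\<in>?\<Omega>. exp (x * (\<Sum>j\<in>{1..p}. \<epsilon> (k, j) * \<epsilon> (l, j))))
      = (\<Sum>\<epsilon>\<in>?\<Omega>. exp (x * (\<Sum>j\<in>{1..p}. \<epsilon> (k, j))))"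
  proof (rule sum.reindex_bij_witness[of _ \<phi> \<phi>])
    fix \<epsilon> assume "\<epsilon> \<in> ?\<Omega>"
    show "exp (x * (\<Sum>j\<in>{1..p}. \<phi> \<epsilon> (k, j))) = exp (x * (\<Sum>j\<in>{1..p}. \<epsilon> (k, j) * \<epsilon> (l, j)))"
      using kl by (intro arg_cong[of _ _ exp] arg_cong2[of _ _ _ _ "(*)"] sum.cong) (auto simp: \<phi>_def E_def)
  qed (use \<phi>_in \<phi>_inv in auto)
  \<comment> \<open>Entries outside row \<open>k\<close> receive the factor 1, so that the sum over
    all matrices becomes a product over all entries.\<close>
  also have "\<dots> = (\<Sum>\<epsilon>\<in>?\<Omega>. \<Prod>e\<in>E. if fst e = k then exp (x * \<epsilon> e) else 1)"
  proof (rule sum.cong[OF refl])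
    fix \<epsilon>
    have "(\<Prod>e\<in>E. if fst e = k then exp (x * \<epsilon> e) else 1)
        = (\<Prod>i\<in>{1..K}. \<Prod>j\<in>{1..p}. if i = k then exp (x * \<epsilon> (i, j)) else 1)"
      unfolding E_def by (subst prod.cartesian_product) (auto intro!: prod.cong)
    also have "\<dots> = (\<Prod>i\<in>{1..K}. if i = k then (\<Prod>j\<in>{1..p}. exp (x * \<epsilon> (k, j))) else 1)"
      by (intro prod.cong refl) auto
    also have "\<dots> = exp (x * (\<Sum>j\<in>{1..p}. \<epsilon> (k, j)))"
      using kl by (simp add: exp_sum sum_distrib_left)
    finally show "exp (x * (\<Sum>j\<in>{1..p}. \<epsilon> (k, j))) = (\<Prod>e\<in>E. if fst e = k then exp (x * \<epsilon> e) else 1)" ..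
  qed
  also have "\<dots> = (\<Prod>e\<in>E. \<Sum>t\<in>{-1, 1}. if fst e = k then exp (x * t) else 1)"
    by (subst prod_sum_PiE) (auto simp: finE)
  also have "\<dots> = (\<Prod>e\<in>E. 2 * (if fst e = k then cosh x else 1))"
    by (intro prod.cong refl) (auto simp: cosh_field_def)
  also have "\<dots> = 2 ^ card E * (\<Prod>i\<in>{1..K}. \<Prod>j\<in>{1..p}. if i = k then cosh x else 1)"
    unfolding prod.distrib E_def by (subst prod.cartesian_product) (auto intro!: prod.cong)
  also have "(\<Prod>i\<in>{1..K}. \<Prod>j\<in>{1..p}. if i = k then cosh x else 1) = (\<Prod>i\<in>{1..K}. if i = k then cosh x ^ p else 1)"
    by (intro prod.cong refl) auto
  also have "\<dots> = cosh x ^ p" using kl by simp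
  finally show ?thesis .
qed

text \<open>Only an upper bound on the inner products is imposed: rows that are nearly opposite are
  far apart anyway.\<close>

definition spread_signs :: "nat \<Rightarrow> nat \<Rightarrow> (nat \<times> nat \<Rightarrow> real) set" where
  "spread_signs K p = {\<epsilon> \<in> ({1..K} \<times> {1..p}) \<rightarrow>\<^sub>E {-1, 1}.
     \<forall>k\<in>{1..K}. \<forall>l\<in>{1..K}. k \<noteq> l \<longrightarrow> (\<Sum>j\<in>{1..p}. \<epsilon> (k, j) * \<epsilon> (l, j)) \<le> real p / 2}"

text \<open>Chernoff and union bound. A given pair of rows violates the condition for a fraction of
  at most \<open>exp (- p / 8)\<close> of the matrices; \<open>p \<ge> 32 * ln K\<close> turns this
  into \<open>1 / K ^ 4\<close>, which beats the at most \<open>K ^ 2\<close> pairs.\<close>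

lemma card_spread_signs:
  assumes "K \<ge> 2" "real p \<ge> 32 * ln (real K)"
  shows "2 * real (card (spread_signs K p)) \<ge> 2 ^ card ({1..K} \<times> {1..p})"
proof -
  define E where "E = {1..K} \<times> {1..p}"
  define N where "N = (2::real) ^ card E"
  let ?\<Omega> = "E \<rightarrow>\<^sub>E {-1, 1::real}"
  let ?s = "\<lambda>\<epsilon> k l. \<Sum>j\<in>{1..p}. \<epsilon> (k, j) * \<epsilon> (l, j) :: real"
  let ?P = "{(k, l). k \<in> {1..K} \<and> l \<in> {1..K} \<and> k \<noteq> l}"
  let ?bad = "\<lambda>(k, l). {\<epsilon> \<in> ?\<Omega>. ?s \<epsilon> k l > real p / 2}"
  have finE: "finite E" by (simp add: E_def)
  note fin\<Omega> = finite_signs[OF finE]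
  have finP: "finite ?P" by (rule finite_subset[of _ "{1..K} \<times> {1..K}"]) auto
  have cardP: "card ?P \<le> K * K"
  proof -
    have "?P \<subseteq> {1..K} \<times> {1..K}" by auto
    from card_mono[OF _ this] show ?thesis by (simp add: card_cartesian_product)
  qed
  have "real (card (?bad kl)) \<le> N * exp (- real p / 8)" if "kl \<in> ?P" for kl
  proof -
    from that obtain k l where kl: "kl = (k, l)" "k \<in> {1..K}" "l \<in> {1..K}" "k \<noteq> l"
      by (cases kl) auto
    have "real (card (?bad kl)) = (\<Sum>\<epsilon>\<in>?bad kl. 1)" by simp
    \<comment> \<open>The exponent 1/2 is the Chernoff parameter: it minimises
      \<open>x ^ 2 / 2 - x / 2\<close>, the rate per coordinate, with value -1/8.\<close>
    also have "\<dots> \<le> (\<Sum>\<epsilon>\<in>?bad kl. exp (1/2 * ?s \<epsilon> k l) * exp (- real p / 4))"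
      by (intro sum_mono) (auto simp: kl exp_add[symmetric])
    also have "\<dots> \<le> (\<Sum>\<epsilon>\<in>?\<Omega>. exp (1/2 * ?s \<epsilon> k l) * exp (- real p / 4))"
      by (intro sum_mono2 fin\<Omega>) (auto simp: kl)
    also have "\<dots> = N * cosh (1/2) ^ p * exp (- real p / 4)"
      unfolding sum_distrib_right[symmetric] N_def E_def by (subst sum_exp_row_product[OF kl(2-4)]) simp
    also have "\<dots> \<le> N * exp ((1/2)\<^sup>2 / 2) ^ p * exp (- real p / 4)"
      by (intro mult_left_mono mult_right_mono power_mono cosh_le_exp_square) (auto simp: N_def)
    also have "\<dots> = N * exp (- real p / 8)"
      by (simp add: exp_of_nat_mult[symmetric] exp_add[symmetric] power2_eq_square mult.assoc)
    finally show ?thesis .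
  qed
  then have "(\<Sum>kl\<in>?P. real (card (?bad kl))) \<le> (\<Sum>kl\<in>?P. N * exp (- real p / 8))" by (rule sum_mono)
  also have "\<dots> = real (card ?P) * (N * exp (- real p / 8))" by simp
  also have "\<dots> \<le> real (K * K) * (N * exp (- (4 * ln (real K))))"
    using assms(2) by (intro mult_mono of_nat_mono cardP mult_left_mono) (auto simp: N_def)
  also have "exp (- (4 * ln (real K))) = 1 / real K ^ 4"
  proof -
    have "exp (4 * ln (real K)) = exp (ln (real K)) ^ 4" by (metis exp_of_nat_mult of_nat_numeral)
    then show ?thesis using assms(1) by (simp add: exp_minus divide_inverse)
  qed
  also have "real (K * K) * (N * (1 / real K ^ 4)) = N / real K ^ 2"
    using assms(1) by (simp add: field_simps power2_eq_square power4_eq_xxxx)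
  also have "\<dots> \<le> N / 2"
  proof (intro divide_left_mono)
    have "real K ^ 2 \<ge> 2 ^ 2" using assms(1) by (intro power_mono) auto
    then show "2 \<le> real K ^ 2" by simp
  qed (use assms(1) in \<open>auto simp: N_def\<close>)
  finally have bad: "(\<Sum>kl\<in>?P. real (card (?bad kl))) \<le> N / 2" .
  have "?\<Omega> - spread_signs K p \<subseteq> (\<Union>kl\<in>?P. ?bad kl)"
    unfolding spread_signs_def E_def[symmetric] by fastforce
  then have "card (?\<Omega> - spread_signs K p) \<le> card (\<Union>kl\<in>?P. ?bad kl)"
    using finP fin\<Omega> by (intro card_mono) auto
  also have "\<dots> \<le> (\<Sum>kl\<in>?P. card (?bad kl))" by (rule card_UN_le[OF finP])
  finally have "real (card (?\<Omega> - spread_signs K p)) \<le> (\<Sum>kl\<in>?P. real (card (?bad kl)))"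
    by (simp only: of_nat_le_iff of_nat_sum[symmetric])
  moreover have "real (card (?\<Omega> - spread_signs K p)) = N - real (card (spread_signs K p))"
  proof -
    have sub: "spread_signs K p \<subseteq> ?\<Omega>" by (auto simp: spread_signs_def E_def)
    show ?thesis
      using card_mono[OF fin\<Omega> sub] sub fin\<Omega> finE
      by (subst card_Diff_subset) (auto intro: finite_subset simp: of_nat_diff card_signs N_def)
  qed
  ultimately show ?thesis using bad by (simp add: N_def E_def)
qed

subsection \<open>Tilted densities and counting permutation tuples\<close>

text \<open>The normalised likelihood ratio of mean \<open>\<nu> + \<sigma>\<^sup>2 * b\<close>
  against mean \<open>\<nu>\<close>.\<close>

definition tilt_density ::
  "'i set \<Rightarrow> nat \<Rightarrow> real \<Rightarrow> ('i \<Rightarrow> nat \<Rightarrow> real) \<Rightarrow> ('i \<Rightarrow> nat \<Rightarrow> real) \<Rightarrow> ('i \<Rightarrow> nat \<Rightarrow> real) \<Rightarrow> real" where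
  "tilt_density I p \<sigma> \<nu> b y = exp (- (\<sigma>\<^sup>2 / 2) * (\<Sum>i\<in>I. \<Sum>j\<in>{1..p}. (b i j)\<^sup>2)) * tilt I p \<nu> b y"

lemma tilt_density_nonneg: "tilt_density I p \<sigma> \<nu> b y \<ge> 0"
  by (simp add: tilt_density_def less_imp_le[OF tilt_pos])

lemma tilt_density_measurable[measurable]:
  "tilt_density I p s \<nu> b \<in> borel_measurable (normal_array I p m \<sigma>)"
proof -
  note tilt_measurable[measurable]
  show ?thesis unfolding tilt_density_def by measurable
qed

text \<open>The product is proportional to the tilt along \<open>b + b'\<close>. The two
  normalisations cancel the squared norms of \<open>b\<close> and \<open>b'\<close>, so only the
  cross term survives.\<close>

lemma integral_tilt_density_mult:
  assumes "\<sigma> > 0" "finite I"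
  shows "has_bochner_integral (normal_array I p \<nu> \<sigma>)
    (\<lambda>y. tilt_density I p \<sigma> \<nu> b y * tilt_density I p \<sigma> \<nu> b' y)
    (exp (\<sigma>\<^sup>2 * (\<Sum>i\<in>I. \<Sum>j\<in>{1..p}. b i j * b' i j)))"
proof -
  let ?q = "\<lambda>b. \<Sum>i\<in>I. \<Sum>j\<in>{1..p}. (b i j)\<^sup>2"
  let ?c = "exp (- (\<sigma>\<^sup>2 / 2) * ?q b) * exp (- (\<sigma>\<^sup>2 / 2) * ?q b')"
  let ?b = "\<lambda>i j. b i j + b' i j"
  have "has_bochner_integral (normal_array I p \<nu> \<sigma>) (\<lambda>y. ?c * tilt I p \<nu> ?b y)
      (?c * exp (\<sigma>\<^sup>2 / 2 * ?q ?b))"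
    by (intro has_bochner_integral_mult_right integral_tilt assms)
  moreover have "?c * tilt I p \<nu> ?b y = tilt_density I p \<sigma> \<nu> b y * tilt_density I p \<sigma> \<nu> b' y" for y
  proof -
    have "tilt I p \<nu> ?b y = tilt I p \<nu> b y * tilt I p \<nu> b' y"
      unfolding tilt_def by (simp add: exp_add[symmetric] sum.distrib distrib_right)
    then show ?thesis unfolding tilt_density_def by (simp add: mult_ac)
  qed
  moreover have "?c * exp (\<sigma>\<^sup>2 / 2 * ?q ?b) = exp (\<sigma>\<^sup>2 * (\<Sum>i\<in>I. \<Sum>j\<in>{1..p}. b i j * b' i j))"
  proof -
    have "?q ?b = ?q b + ?q b' + 2 * (\<Sum>i\<in>I. \<Sum>j\<in>{1..p}. b i j * b' i j)"
      by (simp add: power2_sum sum.distrib sum_distrib_left mult.assoc)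
    then show ?thesis by (simp add: exp_add[symmetric] algebra_simps add_divide_distrib)
  qed
  ultimately show ?thesis by simp
qed

lemma normal_array_cong:
  assumes "\<And>i j. i \<in> I \<Longrightarrow> j \<in> {1..p} \<Longrightarrow> m i j = m' i j"
  shows "normal_array I p m \<sigma> = normal_array I p m' \<sigma>"
  unfolding normal_array_def isotropic_normal_def using assms by (intro PiM_cong refl) simp

lemma obs_dist_eq_density:
  assumes "\<sigma> > 0"
    and "\<And>k m j. k \<in> {1..K} \<Longrightarrow> m \<in> {1..M} \<Longrightarrow> j \<in> {1..p} \<Longrightarrow>
      \<mu> (\<pi> m k) j = \<nu> (k, m) j + \<sigma>\<^sup>2 * b (k, m) j"
  shows "obs_dist K M p \<sigma> \<mu> \<pi> = density (normal_array ({1..K} \<times> {1..M}) p \<nu> \<sigma>)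
    (\<lambda>y. ennreal (tilt_density ({1..K} \<times> {1..M}) p \<sigma> \<nu> b y))"
proof -
  have "obs_dist K M p \<sigma> \<mu> \<pi> = normal_array ({1..K} \<times> {1..M}) p (\<lambda>i j. \<nu> i j + \<sigma>\<^sup>2 * b i j) \<sigma>"
    unfolding obs_dist_eq_normal_array using assms(2) by (intro normal_array_cong) auto
  then show ?thesis
    unfolding tilt_density_def by (simp add: normal_array_tilt[OF assms(1)])
qed

section \<open>Counting permutation tuples\<close>

lemma card_perms: "card (perms K) = fact K"
  unfolding perms_def by (rule card_permutations) auto

lemma card_perm_tuples: "card (perm_tuples K M) = fact K ^ M"
  unfolding perm_tuples_def by (simp add: card_PiE card_perms)

text \<open>A tuple near a given \<open>\<tau>\<close> is encoded by the set of positions where it differs from \<open>\<tau>\<close> and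
  its values there.\<close>

lemma card_hamming_ball:
  fixes \<tau> :: "nat \<Rightarrow> nat \<Rightarrow> nat"
  assumes "K \<ge> 1"
  shows "real (card {\<pi> \<in> perm_tuples K M. (\<Sum>k\<in>{1..K}. \<Sum>m\<in>{1..M}. of_bool (\<tau> m k \<noteq> \<pi> m k)) \<le> d})
    \<le> 2 ^ (K * M) * real K powr d"
proof -
  define I where "I = {1..K} \<times> {1..M}"
  define A where "A = {\<pi> \<in> perm_tuples K M. (\<Sum>k\<in>{1..K}. \<Sum>m\<in>{1..M}. of_bool (\<tau> m k \<noteq> \<pi> m k)) \<le> d}"
  define S where "S \<pi> = {(k, m) \<in> I. \<tau> m k \<noteq> \<pi> m k}" for \<pi> :: "nat \<Rightarrow> nat \<Rightarrow> nat"
  define \<phi> where "\<phi> \<pi> = (S \<pi>, \<lambda>(k, m)\<in>S \<pi>. \<pi> m k)" for \<pi> :: "nat \<Rightarrow> nat \<Rightarrow> nat"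
  define P where "P = {T \<in> Pow I. real (card T) \<le> d}"
  have finI: "finite I" by (simp add: I_def)
  have finP: "finite P" by (simp add: P_def finI)
  have finT: "finite T" if "T \<in> P" for T using that finI by (auto simp: P_def intro: finite_subset)
  have cardS: "real (card (S \<pi>)) = (\<Sum>k\<in>{1..K}. \<Sum>m\<in>{1..M}. of_bool (\<tau> m k \<noteq> \<pi> m k))" for \<pi>
  proof -
    have "(\<Sum>k\<in>{1..K}. \<Sum>m\<in>{1..M}. of_bool (\<tau> m k \<noteq> \<pi> m k)) = (\<Sum>(k, m)\<in>I. of_bool (\<tau> m k \<noteq> \<pi> m k) :: real)"
      unfolding I_def by (rule sum.cartesian_product)
    also have "\<dots> = (\<Sum>x\<in>I. if x \<in> S \<pi> then 1 else 0)"
      by (intro sum.cong refl) (auto simp: S_def)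
    also have "\<dots> = real (card (I \<inter> S \<pi>))" using finI by (simp add: sum.If_cases Int_def)
    also have "I \<inter> S \<pi> = S \<pi>" by (auto simp: S_def)
    finally show ?thesis by simp
  qed
  have "inj_on \<phi> A"
  proof (rule inj_onI)
    fix \<pi> \<pi>' assume A: "\<pi> \<in> A" "\<pi>' \<in> A" and eq: "\<phi> \<pi> = \<phi> \<pi>'"
    have SS: "S \<pi> = S \<pi>'" using eq by (simp add: \<phi>_def)
    have on_I: "\<pi> m k = \<pi>' m k" if "(k, m) \<in> I" for k m
    proof (cases "(k, m) \<in> S \<pi>")
      case True
      have "(\<lambda>(k, m)\<in>S \<pi>. \<pi> m k) = (\<lambda>(k, m)\<in>S \<pi>'. \<pi>' m k)"
        using arg_cong[OF eq, of snd] by (simp only: \<phi>_def snd_conv)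
      from fun_cong[OF this, of "(k, m)"] show ?thesis using True SS by simp
    next
      case False
      then have "(k, m) \<notin> S \<pi>'" using SS by simp
      with False that show ?thesis by (auto simp: S_def)
    qed
    have tup: "\<pi> \<in> perm_tuples K M" "\<pi>' \<in> perm_tuples K M" using A by (auto simp: A_def)
    show "\<pi> = \<pi>'"
    proof (rule PiE_ext[OF tup[unfolded perm_tuples_def]])
      fix m assume m: "m \<in> {1..M}"
      then have "\<pi> m permutes {1..K}" "\<pi>' m permutes {1..K}"
        using tup by (auto simp: perm_tuples_def perms_def)
      then show "\<pi> m = \<pi>' m"
        using on_I m by (intro ext) (metis I_def SigmaI permutes_not_in)
    qed
  qed
  moreover have "\<phi> ` A \<subseteq> Sigma P (\<lambda>T. T \<rightarrow>\<^sub>E {1..K})"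
  proof
    fix x assume "x \<in> \<phi> ` A"
    then obtain \<pi> where \<pi>: "\<pi> \<in> A" "x = \<phi> \<pi>" by auto
    have "\<pi> m k \<in> {1..K}" if "(k, m) \<in> S \<pi>" for k m
    proof -
      have "m \<in> {1..M}" "k \<in> {1..K}" using that by (auto simp: S_def I_def)
      moreover from this have "\<pi> m permutes {1..K}" using \<pi> by (auto simp: A_def perm_tuples_def perms_def)
      ultimately show ?thesis by (metis permutes_in_image)
    qed
    then have "(\<lambda>(k, m)\<in>S \<pi>. \<pi> m k) \<in> S \<pi> \<rightarrow>\<^sub>E {1..K}" by (intro PiE_I) auto
    moreover have "S \<pi> \<in> P" using \<pi>(1) cardS[of \<pi>] by (auto simp: P_def A_def S_def)
    ultimately show "x \<in> Sigma P (\<lambda>T. T \<rightarrow>\<^sub>E {1..K})" by (simp add: \<pi>(2) \<phi>_def)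
  qed
  moreover have "finite (Sigma P (\<lambda>T. T \<rightarrow>\<^sub>E {1..K}))"
    using finP finT by (intro finite_SigmaI finite_PiE) auto
  ultimately have "card A \<le> card (Sigma P (\<lambda>T. T \<rightarrow>\<^sub>E {1..K}))"
    by (rule card_inj_on_le)
  also have "\<dots> = (\<Sum>T\<in>P. K ^ card T)"
    using finP finT by (subst card_SigmaI) (auto intro!: sum.cong finite_PiE simp: card_PiE)
  finally have "real (card A) \<le> (\<Sum>T\<in>P. real K ^ card T)"
    by (simp only: of_nat_le_iff of_nat_sum[symmetric] of_nat_power[symmetric])
  \<comment> \<open>Crude but sufficient: each position set admits at most \<open>K powr d\<close>
    values, and all \<open>2 ^ (K * M)\<close> position sets are allowed.\<close>
  also have "\<dots> \<le> (\<Sum>T\<in>P. real K powr d)"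
    using assms by (intro sum_mono) (auto simp: P_def powr_realpow[symmetric] intro!: powr_mono)
  also have "\<dots> = real (card P) * real K powr d" by simp
  also have "\<dots> \<le> real (card (Pow I)) * real K powr d"
    using finI by (intro mult_right_mono of_nat_mono card_mono) (auto simp: P_def)
  also have "\<dots> = 2 ^ (K * M) * real K powr d"
    using finI by (simp add: card_Pow I_def card_cartesian_product)
  finally show ?thesis unfolding A_def .
qed

text \<open>The ball for \<open>err\<close> is a union of Hamming balls around the relabelled
  tuples. The factor \<open>fact K\<close> for the relabelling will use up one of the
  \<open>M\<close> factors in the total number of tuples.\<close>

lemma card_err_ball:
  assumes "K \<ge> 1" "M \<ge> 1"
  shows "real (card {\<pi> \<in> perm_tuples K M. err K M \<pi>' \<pi> \<le> c})
    \<le> fact K * (2 ^ (K * M) * real K powr (c * (real K * real M)))"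
proof -
  let ?B = "\<lambda>\<psi>. {\<pi> \<in> perm_tuples K M.
    (\<Sum>k\<in>{1..K}. \<Sum>m\<in>{1..M}. of_bool (\<psi> (\<pi>' m k) \<noteq> \<pi> m k)) \<le> c * (real K * real M)}"
  have "{\<pi> \<in> perm_tuples K M. err K M \<pi>' \<pi> \<le> c} \<subseteq> (\<Union>\<psi>\<in>perms K. ?B \<psi>)"
    using assms by (auto simp: err_le_iff field_simps)
  then have "card {\<pi> \<in> perm_tuples K M. err K M \<pi>' \<pi> \<le> c} \<le> card (\<Union>\<psi>\<in>perms K. ?B \<psi>)"
    by (intro card_mono) (auto simp: finite_perms finite_perm_tuples)
  also have "\<dots> \<le> (\<Sum>\<psi>\<in>perms K. card (?B \<psi>))" by (rule card_UN_le[OF finite_perms])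
  finally have "real (card {\<pi> \<in> perm_tuples K M. err K M \<pi>' \<pi> \<le> c}) \<le> (\<Sum>\<psi>\<in>perms K. real (card (?B \<psi>)))"
    by (simp only: of_nat_le_iff of_nat_sum[symmetric])
  also have "\<dots> \<le> (\<Sum>\<psi>\<in>perms K. 2 ^ (K * M) * real K powr (c * (real K * real M)))"
    by (intro sum_mono card_hamming_ball[OF assms(1)])
  finally show ?thesis by (simp add: card_perms)
qed

subsection \<open>Partial recovery\<close>

definition sign_means :: "nat \<Rightarrow> nat \<Rightarrow> real \<Rightarrow> (nat \<times> nat \<Rightarrow> real) \<Rightarrow> nat \<Rightarrow> nat \<Rightarrow> real" where
  "sign_means K p a \<epsilon> = (\<lambda>k\<in>{1..K}. \<lambda>j\<in>{1..p}. a * \<epsilon> (k, j))"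

text \<open>Signs square to one, so the squared distance of two rows is \<open>2 * a\<^sup>2\<close>
  times the difference of \<open>p\<close> and their inner product. As the latter is at most
  \<open>p / 2\<close>, at least \<open>a\<^sup>2 * p\<close> remains.\<close>

lemma sign_means_in_Theta:
  assumes "\<epsilon> \<in> spread_signs K p" and \<sigma>: "\<sigma> > 0" and a: "a\<^sup>2 * real p = 2 * \<sigma>\<^sup>2 * \<Delta>\<^sup>2"
  shows "sign_means K p a \<epsilon> \<in> Theta K p \<sigma> \<Delta>"
proof -
  have "\<Delta>\<^sup>2 \<le> (L2_set (\<lambda>j. sign_means K p a \<epsilon> k j - sign_means K p a \<epsilon> l j) {1..p})\<^sup>2 / (2 * \<sigma>\<^sup>2)"
    if kl: "k \<in> {1..K}" "l \<in> {1..K}" "k \<noteq> l" for k l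
  proof -
    have sgn: "\<epsilon> (i, j) * \<epsilon> (i, j) = 1" if "i \<in> {1..K}" "j \<in> {1..p}" for i j
    proof -
      have "\<epsilon> (i, j) \<in> {-1, 1}" using assms(1) that unfolding spread_signs_def by blast
      then show ?thesis by auto
    qed
    have "(L2_set (\<lambda>j. sign_means K p a \<epsilon> k j - sign_means K p a \<epsilon> l j) {1..p})\<^sup>2
        = (\<Sum>j\<in>{1..p}. (a * \<epsilon> (k, j) - a * \<epsilon> (l, j))\<^sup>2)"
      unfolding L2_set_def using kl by (simp add: sum_nonneg sign_means_def)
    also have "\<dots> = (\<Sum>j\<in>{1..p}. 2 * a\<^sup>2 - 2 * a\<^sup>2 * (\<epsilon> (k, j) * \<epsilon> (l, j)))"
    proof (rule sum.cong[OF refl])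
      fix j assume j: "j \<in> {1..p}"
      have "(a * \<epsilon> (k, j) - a * \<epsilon> (l, j))\<^sup>2
        = a\<^sup>2 * (\<epsilon> (k, j) * \<epsilon> (k, j)) + a\<^sup>2 * (\<epsilon> (l, j) * \<epsilon> (l, j)) - 2 * a\<^sup>2 * (\<epsilon> (k, j) * \<epsilon> (l, j))"
        by (simp add: power2_eq_square algebra_simps)
      then show "(a * \<epsilon> (k, j) - a * \<epsilon> (l, j))\<^sup>2 = 2 * a\<^sup>2 - 2 * a\<^sup>2 * (\<epsilon> (k, j) * \<epsilon> (l, j))"
        using sgn[OF kl(1) j] sgn[OF kl(2) j] by simp
    qed
    also have "\<dots> = 2 * a\<^sup>2 * real p - 2 * a\<^sup>2 * (\<Sum>j\<in>{1..p}. \<epsilon> (k, j) * \<epsilon> (l, j))"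
      by (simp add: sum_subtractf sum_distrib_left)
    also have "\<dots> \<ge> 2 * a\<^sup>2 * real p - 2 * a\<^sup>2 * (real p / 2)"
      using assms(1) kl by (intro diff_left_mono mult_left_mono) (auto simp: spread_signs_def)
    finally have "2 * \<sigma>\<^sup>2 * \<Delta>\<^sup>2 \<le> (L2_set (\<lambda>j. sign_means K p a \<epsilon> k j - sign_means K p a \<epsilon> l j) {1..p})\<^sup>2"
      using a by simp
    then show ?thesis using \<sigma> by (simp add: pos_le_divide_eq mult.commute)
  qed
  then show ?thesis by (auto simp: Theta_def sign_means_def)
qed

text \<open>The mixture over sign matrices has a likelihood ratio against pure noise whose second moment
  does not depend on the permutations, because the same means occur in each of the \<open>M\<close> samples.\<close>

lemma sign_mixture_second_moment:
  fixes G :: "(nat \<times> nat \<Rightarrow> real) set" and a :: real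
  defines "E \<equiv> \<lambda>K p. {1..K} \<times> {1..p::nat}"
  assumes \<sigma>: "\<sigma> > 0" and G: "G \<subseteq> E K p \<rightarrow>\<^sub>E {-1, 1}" "2 ^ card (E K p) \<le> 2 * real (card G)"
    and \<pi>: "\<pi> \<in> perm_tuples K M"
  defines "b \<equiv> \<lambda>\<epsilon> (k, m) j. a / \<sigma>\<^sup>2 * \<epsilon> (\<pi> m k, j)"
  defines "L \<equiv> \<lambda>\<epsilon>. tilt_density ({1..K} \<times> {1..M}) p \<sigma> (\<lambda>_ _. 0) (b \<epsilon>)"
  shows "(\<integral>\<^sup>+ y. ennreal (((\<Sum>\<epsilon>\<in>G. L \<epsilon> y) / real (card G))\<^sup>2) \<partial>normal_array ({1..K} \<times> {1..M}) p (\<lambda>_ _. 0) \<sigma>)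
     \<le> ennreal (4 * cosh (real M * a\<^sup>2 / \<sigma>\<^sup>2) ^ (K * p))"
proof -
  let ?N = "normal_array ({1..K} \<times> {1..M}) p (\<lambda>_ _. 0) \<sigma>" and ?g = "real (card G)"
  let ?x = "real M * a\<^sup>2 / \<sigma>\<^sup>2" and ?\<Omega> = "E K p \<rightarrow>\<^sub>E {-1, 1::real}"
  have finE: "finite (E K p)" by (simp add: E_def)
  note fin\<Omega> = finite_signs[OF finE]
  have g0: "?g > 0" using G(2) by (smt (verit) zero_less_power)
  have cross: "\<sigma>\<^sup>2 * (\<Sum>i\<in>{1..K} \<times> {1..M}. \<Sum>j\<in>{1..p}. b \<epsilon> i j * b \<epsilon>' i j)
      = ?x * (\<Sum>e\<in>E K p. \<epsilon> e * \<epsilon>' e)" for \<epsilon> \<epsilon>'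
  proof -
    let ?h = "\<lambda>k. \<Sum>j\<in>{1..p}. \<epsilon> (k, j) * \<epsilon>' (k, j)"
    have "(\<Sum>i\<in>{1..K} \<times> {1..M}. \<Sum>j\<in>{1..p}. b \<epsilon> i j * b \<epsilon>' i j)
        = (\<Sum>(k, m)\<in>{1..K} \<times> {1..M}. (a / \<sigma>\<^sup>2)\<^sup>2 * ?h (\<pi> m k))"
      by (intro sum.cong refl) (auto simp: b_def sum_distrib_left power2_eq_square mult_ac)
    also have "\<dots> = (\<Sum>k\<in>{1..K}. \<Sum>m\<in>{1..M}. (a / \<sigma>\<^sup>2)\<^sup>2 * ?h (\<pi> m k))"
      by (rule sum.cartesian_product[symmetric])
    also have "\<dots> = (\<Sum>m\<in>{1..M}. \<Sum>k\<in>{1..K}. (a / \<sigma>\<^sup>2)\<^sup>2 * ?h (\<pi> m k))"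
      by (rule sum.swap)
    also have "\<dots> = (\<Sum>m\<in>{1..M}. \<Sum>k\<in>{1..K}. (a / \<sigma>\<^sup>2)\<^sup>2 * ?h k)"
    proof (rule sum.cong[OF refl])
      fix m assume "m \<in> {1..M}"
      then have "\<pi> m permutes {1..K}" using \<pi> by (auto simp: perm_tuples_def perms_def)
      from sum.permute[OF this, of "\<lambda>k. (a / \<sigma>\<^sup>2)\<^sup>2 * ?h k"]
      show "(\<Sum>k\<in>{1..K}. (a / \<sigma>\<^sup>2)\<^sup>2 * ?h (\<pi> m k)) = (\<Sum>k\<in>{1..K}. (a / \<sigma>\<^sup>2)\<^sup>2 * ?h k)"
        by (simp add: o_def)
    qed
    also have "\<dots> = real M * (a / \<sigma>\<^sup>2)\<^sup>2 * (\<Sum>k\<in>{1..K}. ?h k)"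
      by (simp add: sum_distrib_left mult.assoc)
    also have "(\<Sum>k\<in>{1..K}. ?h k) = (\<Sum>e\<in>E K p. \<epsilon> e * \<epsilon>' e)"
      unfolding E_def by (subst sum.cartesian_product) (auto intro!: sum.cong)
    finally show ?thesis using \<sigma> by (simp add: power2_eq_square field_simps)
  qed
  have "has_bochner_integral ?N (\<lambda>y. (\<Sum>\<epsilon>\<in>G. \<Sum>\<epsilon>'\<in>G. L \<epsilon> y * L \<epsilon>' y) / ?g\<^sup>2)
      ((\<Sum>\<epsilon>\<in>G. \<Sum>\<epsilon>'\<in>G. exp (?x * (\<Sum>e\<in>E K p. \<epsilon> e * \<epsilon>' e))) / ?g\<^sup>2)"
    unfolding L_def cross[symmetric]
    by (intro has_bochner_integral_divide_zero has_bochner_integral_sum integral_tilt_density_mult \<sigma>) auto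
  moreover have "(\<Sum>\<epsilon>\<in>G. \<Sum>\<epsilon>'\<in>G. L \<epsilon> y * L \<epsilon>' y) / ?g\<^sup>2 = ((\<Sum>\<epsilon>\<in>G. L \<epsilon> y) / ?g)\<^sup>2" for y
    by (simp add: power_divide power2_eq_square sum_product)
  ultimately have int: "has_bochner_integral ?N (\<lambda>y. ((\<Sum>\<epsilon>\<in>G. L \<epsilon> y) / ?g)\<^sup>2)
      ((\<Sum>\<epsilon>\<in>G. \<Sum>\<epsilon>'\<in>G. exp (?x * (\<Sum>e\<in>E K p. \<epsilon> e * \<epsilon>' e))) / ?g\<^sup>2)"
    by simp
  have "(\<integral>\<^sup>+ y. ennreal (((\<Sum>\<epsilon>\<in>G. L \<epsilon> y) / ?g)\<^sup>2) \<partial>?N)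
      = ennreal ((\<Sum>\<epsilon>\<in>G. \<Sum>\<epsilon>'\<in>G. exp (?x * (\<Sum>e\<in>E K p. \<epsilon> e * \<epsilon>' e))) / ?g\<^sup>2)"
    using int by (subst nn_integral_eq_integral)
      (auto simp: has_bochner_integral_iff)
  also have "\<dots> \<le> ennreal (4 * cosh ?x ^ (K * p))"
  proof (rule ennreal_leI)
    \<comment> \<open>All summands are positive, so both sums may be extended from \<open>G\<close>
      to all sign matrices, where the signs are independent. As \<open>G\<close> contains at least
      half of them, this costs a factor 4.\<close>
    have "(\<Sum>\<epsilon>\<in>G. \<Sum>\<epsilon>'\<in>G. exp (?x * (\<Sum>e\<in>E K p. \<epsilon> e * \<epsilon>' e)))
        \<le> (\<Sum>\<epsilon>'\<in>?\<Omega>. \<Sum>\<epsilon>\<in>?\<Omega>. exp (?x * (\<Sum>e\<in>E K p. \<epsilon> e * \<epsilon>' e)))"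
    proof -
      have "(\<Sum>\<epsilon>\<in>G. \<Sum>\<epsilon>'\<in>G. exp (?x * (\<Sum>e\<in>E K p. \<epsilon> e * \<epsilon>' e)))
        \<le> (\<Sum>\<epsilon>\<in>G. \<Sum>\<epsilon>'\<in>?\<Omega>. exp (?x * (\<Sum>e\<in>E K p. \<epsilon> e * \<epsilon>' e)))"
        by (intro sum_mono sum_mono2 fin\<Omega> G) auto
      also have "\<dots> \<le> (\<Sum>\<epsilon>\<in>?\<Omega>. \<Sum>\<epsilon>'\<in>?\<Omega>. exp (?x * (\<Sum>e\<in>E K p. \<epsilon> e * \<epsilon>' e)))"
        by (intro sum_mono2 fin\<Omega> G) (auto intro!: sum_nonneg)
      finally show ?thesis by (subst sum.swap)
    qed
    also have "\<dots> = (\<Sum>\<epsilon>'\<in>?\<Omega>. (2 * cosh ?x) ^ card (E K p))"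
      by (intro sum.cong refl rademacher_mgf finE) (auto simp: PiE_iff)
    also have "\<dots> = (2 ^ card (E K p))\<^sup>2 * cosh ?x ^ (K * p)"
      by (simp add: card_signs[OF finE] power_mult_distrib power2_eq_square)
        (simp add: E_def card_cartesian_product)
    also have "\<dots> \<le> (2 * ?g)\<^sup>2 * cosh ?x ^ (K * p)"
      by (intro mult_right_mono power_mono G) auto
    finally show "(\<Sum>\<epsilon>\<in>G. \<Sum>\<epsilon>'\<in>G. exp (?x * (\<Sum>e\<in>E K p. \<epsilon> e * \<epsilon>' e))) / ?g\<^sup>2 \<le> 4 * cosh ?x ^ (K * p)"
      using g0 by (simp add: pos_divide_le_eq power2_eq_square mult_ac)
  qed
  finally show ?thesis .
qed

text \<open>The larger of the two terms dominates the sum up to a factor 2. The second alternative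
  is squared to remove the root, and is used with a bound quadratic in \<open>d2\<close>.\<close>

lemma separation_cases:
  fixes d2 c L r :: real
  assumes "d2 \<le> c * (L + sqrt (r * L))" "d2 \<ge> 0" "c \<ge> 0" "L \<ge> 0" "r \<ge> 0"
  shows "d2 \<le> 2 * c * L \<or> d2\<^sup>2 \<le> 4 * c\<^sup>2 * (r * L)"
proof (cases "sqrt (r * L) \<le> L")
  case True
  then show ?thesis using assms(1) mult_left_mono[of "L + sqrt (r * L)" "2 * L" c] assms(3) by simp
next
  case False
  then have "d2 \<le> c * (2 * sqrt (r * L))"
    using assms(1) mult_left_mono[of "L + sqrt (r * L)" "2 * sqrt (r * L)" c] assms(3) by simp
  then have "d2\<^sup>2 \<le> (c * (2 * sqrt (r * L)))\<^sup>2" using assms(2) by (rule power_mono)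
  then show ?thesis using assms by (simp add: power_mult_distrib)
qed

lemma minimax_partial_lower_bound:
  assumes M: "M \<ge> 2" and p: "p \<ge> 1" and \<sigma>: "\<sigma> > 0"
    and pK: "real p \<ge> 32 * ln (real K)" and K: "K \<ge> 65536"
    and sep: "\<Delta>\<^sup>2 \<le> 1/64 * (ln (real K) + sqrt (real p / real M * ln (real K)))"
  shows "minimax_partial K M p \<sigma> \<Delta> \<ge> ennreal (1/16 / 2)"
proof (rule minimax_partialI[OF \<sigma>])
  fix est assume est: "est \<in> estimators K M p"
  define a where "a = sqrt (2 * \<sigma>\<^sup>2 * \<Delta>\<^sup>2 / real p)"
  define x where "x = real M * a\<^sup>2 / \<sigma>\<^sup>2"
  define L where "L = ln (real K)"
  define n where "n = real K * real M"
  have a2: "a\<^sup>2 * real p = 2 * \<sigma>\<^sup>2 * \<Delta>\<^sup>2" using p by (simp add: a_def)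
  have x_eq: "x * real p = 2 * real M * \<Delta>\<^sup>2"
    using a2 \<sigma> by (simp add: x_def field_simps)
  have x0: "x \<ge> 0" by (simp add: x_def)
  \<comment> \<open>The constant 65536 is \<open>2 ^ 16\<close>; it makes a factor 2 per entry of
    the tuple cost no more than \<open>exp (L / 16)\<close>.\<close>
  have L16: "16 * ln 2 \<le> L"
  proof -
    have "16 * ln 2 = ln (2 ^ 16 :: real)" by (subst ln_realpow) auto
    also have "\<dots> \<le> L" unfolding L_def using K by (subst ln_le_cancel_iff) auto
    finally show ?thesis .
  qed
  moreover have ln2: "ln (2::real) \<ge> 1/2" using ln_le_minus_one[of "1/2 :: real"] by (simp add: ln_div)
  ultimately have L2: "L \<ge> 2" "L \<ge> 0" by auto
  have nKM: "n \<ge> 4" "n \<ge> 0"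
    using K M mult_mono[of 2 "real K" 2 "real M"] by (auto simp: n_def)
  \<comment> \<open>The first case determines the constant 1/64: there
    \<open>x * p = 2 * M * \<Delta>\<^sup>2\<close> is at most \<open>M * L / 16\<close>, with no
    slack. The second case has room to spare.\<close>
  have B: "cosh x ^ (K * p) \<le> exp (n * L / 16)"
  proof -
    consider "\<Delta>\<^sup>2 \<le> 2 * (1/64) * L" | "(\<Delta>\<^sup>2)\<^sup>2 \<le> 4 * (1/64)\<^sup>2 * (real p / real M * L)"
      using separation_cases[OF sep] L2 by (auto simp: L_def)
    then show ?thesis
    proof cases
      case 1
      have "cosh x ^ (K * p) \<le> exp x ^ (K * p)" by (intro power_mono cosh_le_exp x0) simp
      also have "\<dots> = exp (real K * (x * real p))" by (simp add: exp_of_nat_mult[symmetric] mult_ac)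
      also have "\<dots> \<le> exp (n * L / 16)"
        using mult_left_mono[OF 1, of "2 * n"] nKM by (simp add: x_eq n_def mult_ac)
      finally show ?thesis .
    next
      case 2
      have "cosh x ^ (K * p) \<le> exp (x\<^sup>2 / 2) ^ (K * p)" by (intro power_mono cosh_le_exp_square) simp
      also have "\<dots> = exp (real K * (x * (x * real p)) / 2)"
        by (simp add: exp_of_nat_mult[symmetric] power2_eq_square mult_ac)
      also have "x * (x * real p) = 4 * (real M)\<^sup>2 * (\<Delta>\<^sup>2)\<^sup>2 / real p"
      proof -
        have "x * (x * real p) = (x * real p)\<^sup>2 / real p" using p by (simp add: power2_eq_square)
        then show ?thesis unfolding x_eq by (simp add: power_mult_distrib)
      qed
      also have "real K * (4 * (real M)\<^sup>2 * (\<Delta>\<^sup>2)\<^sup>2 / real p) / 2 = (2 * real K * (real M)\<^sup>2 / real p) * (\<Delta>\<^sup>2)\<^sup>2"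
        by simp
      also have "exp \<dots> \<le> exp ((2 * real K * (real M)\<^sup>2 / real p) * (4 * (1/64)\<^sup>2 * (real p / real M * L)))"
        using 2 by (intro iffD2[OF exp_le_cancel_iff] mult_left_mono) auto
      also have "(2 * real K * (real M)\<^sup>2 / real p) * (4 * (1/64)\<^sup>2 * (real p / real M * L)) = n * L / 512"
        using p M by (simp add: n_def power2_eq_square)
      also have "exp (n * L / 512) \<le> exp (n * L / 16)"
        using nKM L2 by simp
      finally show ?thesis .
    qed
  qed
  define I where "I = {1..K} \<times> {1..M}"
  define N where "N = normal_array I p (\<lambda>_ _. 0) \<sigma>"
  define b where "b \<pi> \<epsilon> = (\<lambda>(k, m) j. a / \<sigma>\<^sup>2 * \<epsilon> (\<pi> m k, j))" for \<pi> :: "nat \<Rightarrow> nat \<Rightarrow> nat" and \<epsilon> :: "nat \<times> nat \<Rightarrow> real"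
  define f where "f \<pi> \<epsilon> = tilt_density I p \<sigma> (\<lambda>_ _. 0) (b \<pi> \<epsilon>)" for \<pi> \<epsilon>
  define G where "G = spread_signs K p"
  define S where "S \<pi> = {y \<in> space (obs_space K M p). err K M (est y) \<pi> \<le> 1/16}" for \<pi>
  have finG: "finite G" unfolding G_def spread_signs_def by (simp add: finite_signs)
  have cardG: "2 ^ card ({1..K} \<times> {1..p}) \<le> 2 * real (card G)"
    unfolding G_def using K pK by (intro card_spread_signs) auto
  moreover have "0 < (2::real) ^ card ({1..K} \<times> {1..p})" by simp
  ultimately have "real (card G) > 0" by linarith
  then have "G \<noteq> {}" by auto
  have sets_N: "sets N = sets (obs_space K M p)"
    unfolding N_def sets_normal_array obs_space_def I_def ..
  have f_meas: "f \<pi> \<epsilon> \<in> borel_measurable N" for \<pi> \<epsilon> unfolding f_def N_def by measurable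
  have "\<exists>\<pi>\<in>perm_tuples K M. \<exists>\<epsilon>\<in>G. emeasure (density N (f \<pi> \<epsilon>)) (S \<pi>) \<le> ennreal (1/2)"
  \<comment> \<open>Relative to the pure noise \<open>N\<close> the reference density is 1, so
    \<open>r\<close> is the squared mixture density itself. The acceptance events are balls of
    radius 1/16 for \<open>err\<close>.\<close>
  proof (rule chi_square_fano[where q = "\<lambda>_. 1" and r = "\<lambda>\<pi> y. ((\<Sum>\<epsilon>\<in>G. f \<pi> \<epsilon> y) / real (card G))\<^sup>2"
        and B = "4 * exp (n * L / 16)" and V = "fact K * (2 ^ (K * M) * real K powr (1/16 * (real K * real M)))"])
    show "perm_tuples K M \<noteq> {}"
      using perms_nonempty by (auto simp: perm_tuples_def PiE_eq_empty_iff)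
    show "(\<lambda>y. ((\<Sum>\<epsilon>\<in>G. f \<pi> \<epsilon> y) / real (card G))\<^sup>2) \<in> borel_measurable N" for \<pi>
      using f_meas by measurable
    show "(\<integral>\<^sup>+ y. ennreal 1 \<partial>N) \<le> 1"
      using prob_space.emeasure_space_1[OF prob_space_normal_array[OF \<sigma>, of I p "\<lambda>_ _. 0"]]
      by (simp add: N_def)
    show "S \<pi> \<in> sets N" for \<pi>
      unfolding S_def sets_N by (rule estimators_event[OF est])
    show "(\<integral>\<^sup>+ y. ennreal (((\<Sum>\<epsilon>\<in>G. f \<pi> \<epsilon> y) / real (card G))\<^sup>2) \<partial>N) \<le> ennreal (4 * exp (n * L / 16))"
      if "\<pi> \<in> perm_tuples K M" for \<pi>
    proof -
      have "(\<integral>\<^sup>+ y. ennreal (((\<Sum>\<epsilon>\<in>G. f \<pi> \<epsilon> y) / real (card G))\<^sup>2) \<partial>N)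
         \<le> ennreal (4 * cosh (real M * a\<^sup>2 / \<sigma>\<^sup>2) ^ (K * p))"
        unfolding f_def N_def b_def I_def
        by (rule sign_mixture_second_moment[OF \<sigma> _ cardG that]) (auto simp: G_def spread_signs_def)
      also have "\<dots> \<le> ennreal (4 * exp (n * L / 16))"
        using B unfolding x_def by (intro ennreal_leI) simp
      finally show ?thesis .
    qed
    show "real (card {\<pi> \<in> perm_tuples K M. y \<in> S \<pi>})
        \<le> fact K * (2 ^ (K * M) * real K powr (1/16 * (real K * real M)))" if "y \<in> space N" for y
    proof -
      have "y \<in> space (obs_space K M p)" using that sets_eq_imp_space_eq[OF sets_N] by simp
      then have "{\<pi> \<in> perm_tuples K M. y \<in> S \<pi>} = {\<pi> \<in> perm_tuples K M. err K M (est y) \<pi> \<le> 1/16}"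
        by (auto simp: S_def)
      then show ?thesis using card_err_ball[of K M "est y" "1/16"] K M by simp
    qed
    show "4 * (fact K * (2 ^ (K * M) * real K powr (1/16 * (real K * real M)))) * (4 * exp (n * L / 16))
        \<le> real (card (perm_tuples K M))"
    proof -
      have K0: "real K > 0" using K by simp
      have e2: "2 ^ (K * M) = exp (n * ln 2)"
      proof -
        have "exp (real (K * M) * ln 2) = exp (ln 2) ^ (K * M)" by (rule exp_of_nat_mult)
        then show ?thesis by (simp add: n_def)
      qed
      have eK: "real K powr (1/16 * (real K * real M)) = exp (n * L / 16)"
        using K0 by (simp add: powr_def n_def L_def)
      have e16: "(16::real) = exp (4 * ln 2)"
      proof -
        have "exp (real 4 * ln 2) = exp (ln 2) ^ 4" by (rule exp_of_nat_mult)
        then show ?thesis by simp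
      qed
      \<comment> \<open>The budget is four times \<open>n * L / 16\<close>: for the constant 16, for
        the choice of positions, for the values at these positions, and for the second
        moment.\<close>
      have "4 * ln 2 \<le> n * ln 2" using nKM ln2 by simp
      moreover have "n * ln 2 \<le> n * L / 16" using mult_left_mono[OF L16, of n] nKM by simp
      ultimately have le: "4 * ln 2 + n * ln 2 + n * L / 16 + n * L / 16 \<le> n * L / 4" by linarith
      have "4 * (fact K * (2 ^ (K * M) * real K powr (1/16 * (real K * real M)))) * (4 * exp (n * L / 16))
          = fact K * (16 * 2 ^ (K * M) * real K powr (1/16 * (real K * real M)) * exp (n * L / 16))"
        by simp
      also have "\<dots> = fact K * exp (4 * ln 2 + n * ln 2 + n * L / 16 + n * L / 16)"
        unfolding e2 eK exp_add by (subst e16) simp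
      also have "\<dots> \<le> fact K * exp (n * L / 4)"
        using le by (intro mult_left_mono) auto
      also have "\<dots> \<le> fact K * exp (real K * L / 2) ^ (M - 1)"
      proof -
        \<comment> \<open>One factor \<open>fact K\<close> has gone into the relabelling; since
          \<open>M \<ge> 2\<close>, the other \<open>M - 1\<close> factors still cover the
          budget.\<close>
        have "real M / 4 \<le> real (M - 1) / 2" using M by (simp add: of_nat_diff)
        then have "real M / 4 * (real K * L) \<le> real (M - 1) / 2 * (real K * L)"
          using L2 by (intro mult_right_mono) auto
        then have "n * L / 4 \<le> real (M - 1) * (real K * L / 2)" by (simp add: n_def mult_ac)
        then show ?thesis by (simp add: exp_of_nat_mult[symmetric])
      qed
      also have "\<dots> \<le> fact K * fact K ^ (M - 1)"
        using exp_le_fact[of K] K L2 by (intro mult_left_mono power_mono) (auto simp: L_def)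
      also have "\<dots> = real (card (perm_tuples K M))"
        unfolding card_perm_tuples using M by (cases M) auto
      finally show ?thesis .
    qed
  qed (use finG \<open>G \<noteq> {}\<close> f_meas in \<open>auto simp: finite_perm_tuples f_def tilt_density_nonneg\<close>)
  then obtain \<pi> \<epsilon> where \<pi>: "\<pi> \<in> perm_tuples K M" and \<epsilon>: "\<epsilon> \<in> G"
    and le: "emeasure (density N (f \<pi> \<epsilon>)) (S \<pi>) \<le> ennreal (1/2)" by blast
  have obs_eq: "obs_dist K M p \<sigma> (sign_means K p a \<epsilon>) \<pi> = density N (f \<pi> \<epsilon>)"
    unfolding N_def f_def I_def
  proof (rule obs_dist_eq_density[OF \<sigma>])
    fix k m j assume km: "k \<in> {1..K}" "m \<in> {1..M}" "j \<in> {1..p}"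
    then have "\<pi> m permutes {1..K}" using \<pi> by (auto simp: perm_tuples_def perms_def)
    then have "\<pi> m k \<in> {1..K}" using km(1) by (simp only: permutes_in_image)
    then show "sign_means K p a \<epsilon> (\<pi> m k) j = 0 + \<sigma>\<^sup>2 * b \<pi> \<epsilon> (k, m) j"
      using km \<sigma> by (simp add: sign_means_def b_def)
  qed
  show "\<exists>\<mu>\<in>Theta K p \<sigma> \<Delta>. \<exists>\<pi>\<in>perm_tuples K M.
      emeasure (obs_dist K M p \<sigma> \<mu> \<pi>) {y \<in> space (obs_space K M p). err K M (est y) \<pi> \<le> 1/16} \<le> ennreal (1/2)"
  proof (intro bexI)
    show "emeasure (obs_dist K M p \<sigma> (sign_means K p a \<epsilon>) \<pi>)
        {y \<in> space (obs_space K M p). err K M (est y) \<pi> \<le> 1/16} \<le> ennreal (1/2)"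
      using le unfolding S_def obs_eq .
    show "sign_means K p a \<epsilon> \<in> Theta K p \<sigma> \<Delta>"
      using \<epsilon> by (intro sign_means_in_Theta \<sigma> a2) (simp add: G_def)
  qed (rule \<pi>)
qed simp

subsection \<open>Hyperbolic functions\<close>

text \<open>Product-to-sum formulas: the square and the product both contain
  \<open>cosh (2 * z - 2 * w) / 2\<close>, and they differ by
  \<open>(cosh (2 * w) - 1) / 2\<close>.\<close>

lemma cosh_square_diff:
  fixes z w :: real
  shows "(cosh (z - w))\<^sup>2 = cosh z * cosh (z - 2 * w) - (sinh w)\<^sup>2"
proof -
  have c2: "cosh (2 * w) = 1 + 2 * (sinh w)\<^sup>2" by (simp add: cosh_double cosh_square_eq)
  have "(cosh (z - w))\<^sup>2 = (cosh z)\<^sup>2 * (1 + (sinh w)\<^sup>2) - cosh z * sinh z * (2 * sinh w * cosh w) + ((cosh z)\<^sup>2 - 1) * (sinh w)\<^sup>2"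
    unfolding cosh_diff using cosh_square_eq[of z] cosh_square_eq[of w]
    by (simp add: power2_diff power_mult_distrib algebra_simps)
  also have "\<dots> = cosh z * cosh (z - 2 * w) - (sinh w)\<^sup>2"
    unfolding cosh_diff c2 sinh_double by (simp add: power2_eq_square algebra_simps)
  finally show ?thesis .
qed

text \<open>The pairs \<open>(\<alpha>, \<beta>)\<close> that occur in the terms
  \<open>exp (\<alpha> * z + \<beta> * w)\<close> below. Finite sums of such exponentials are what
  \<open>integral_prod_tilt\<close> evaluates when \<open>z\<close> and \<open>w\<close> are linear
  in the data.\<close>

definition exponents :: "(real \<times> real) set" where
  "exponents = {-1, 0, 1} \<times> {-2, 0, 2}"

definition hyperbolic :: "(real \<times> real \<Rightarrow> real) \<Rightarrow> real \<Rightarrow> real \<Rightarrow> real" where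
  "hyperbolic c z w = (\<Sum>t\<in>exponents. c t * exp (fst t * z + snd t * w))"

definition signal_coeff :: "real \<times> real \<Rightarrow> real" where
  "signal_coeff = (\<lambda>(\<alpha>, \<beta>). if \<beta> = 0 \<and> \<alpha> \<noteq> 0 then 1/2 else 0)"

definition rough_coeff :: "real \<times> real \<Rightarrow> real" where
  "rough_coeff = (\<lambda>(\<alpha>, \<beta>). if \<alpha> * \<beta> = -2 then 1/2 else 0)"

text \<open>Obtained by expanding \<open>cosh (z - 2 * w) - (sinh w)\<^sup>2 * (2 - cosh z)\<close>.
  The product \<open>\<alpha> * \<beta>\<close> is -2 on the exponents of
  \<open>cosh (z - 2 * w)\<close> and 2 on those of \<open>cosh (z + 2 * w)\<close>.\<close>

definition fine_coeff :: "real \<times> real \<Rightarrow> real" where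
  "fine_coeff = (\<lambda>(\<alpha>, \<beta>). if \<alpha> * \<beta> = -2 then 5/8 else if \<alpha> * \<beta> = 2 then 1/8
     else if \<alpha> \<noteq> 0 then -1/4 else if \<beta> \<noteq> 0 then -1/2 else 1)"

lemma sum_exponents:
  fixes f :: "real \<times> real \<Rightarrow> real"
  shows "(\<Sum>t\<in>exponents. f t) = f (-1, -2) + f (-1, 0) + f (-1, 2) + f (0, -2) + f (0, 0) + f (0, 2)
    + f (1, -2) + f (1, 0) + f (1, 2)"
proof -
  have "(\<Sum>t\<in>exponents. f t) = (\<Sum>\<alpha>\<in>{-1, 0, 1}. \<Sum>\<beta>\<in>{-2, 0, 2}. f (\<alpha>, \<beta>))"
    unfolding exponents_def by (subst sum.cartesian_product) (auto intro!: sum.cong)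
  then show ?thesis by simp
qed

lemma finite_exponents: "finite exponents" by (simp add: exponents_def)

lemma hyperbolic_signal: "hyperbolic signal_coeff z w = cosh z"
  by (simp add: hyperbolic_def sum_exponents signal_coeff_def cosh_field_def field_simps)

lemma hyperbolic_rough: "hyperbolic rough_coeff z w = cosh (z - 2 * w)"
  by (simp add: hyperbolic_def sum_exponents rough_coeff_def cosh_field_def field_simps)

lemma hyperbolic_fine: "hyperbolic fine_coeff z w = cosh (z - 2 * w) - (sinh w)\<^sup>2 * (2 - cosh z)"
proof -
  have "hyperbolic fine_coeff z w = 5/4 * cosh (z - 2 * w) + 1/4 * cosh (z + 2 * w) - cosh z / 2 - cosh (2 * w) + 1"
    by (simp add: hyperbolic_def sum_exponents fine_coeff_def cosh_field_def field_simps)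
  moreover have c2: "cosh (2 * w) = 1 + 2 * (sinh w)\<^sup>2" by (simp add: cosh_double cosh_square_eq)
  ultimately show ?thesis unfolding cosh_diff cosh_add c2 by (simp add: algebra_simps)
qed

text \<open>A majorant of the swapped likelihood ratio squared, times the reference density, in the
  multiplied-out form required by \<open>chi_square_fano\<close>.\<close>

definition dominates_swap :: "(real \<times> real \<Rightarrow> real) \<Rightarrow> bool" where
  "dominates_swap c \<longleftrightarrow> (\<forall>z w. (cosh (z - w))\<^sup>2 \<le> hyperbolic c z w * cosh z)"

text \<open>The nonnegative term \<open>(sinh w)\<^sup>2\<close> is simply dropped.\<close>

lemma dominates_swap_rough: "dominates_swap rough_coeff"
  unfolding dominates_swap_def hyperbolic_rough cosh_square_diff by (simp add: mult.commute)

text \<open>This is the tangent bound \<open>1 / cosh z \<ge> 2 - cosh z\<close>, applied to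
  \<open>cosh (z - w)\<^sup>2 / cosh z = cosh (z - 2 w) - sinh w\<^sup>2 / cosh z\<close>.\<close>

lemma dominates_swap_fine: "dominates_swap fine_coeff"
  unfolding dominates_swap_def hyperbolic_fine cosh_square_diff
proof (intro allI)
  fix z w :: real
  have "0 \<le> (sinh w)\<^sup>2 * (cosh z - 1)\<^sup>2" by simp
  then show "cosh z * cosh (z - 2 * w) - (sinh w)\<^sup>2
      \<le> (cosh (z - 2 * w) - (sinh w)\<^sup>2 * (2 - cosh z)) * cosh z"
    by (simp add: power2_eq_square algebra_simps)
qed

lemma hyperbolic_nonneg: "dominates_swap c \<Longrightarrow> hyperbolic c z w \<ge> 0"
  unfolding dominates_swap_def
  by (metis cosh_real_pos zero_le_mult_iff zero_le_power2 order_trans not_less)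

text \<open>The mean of \<open>exp (\<alpha> * Z + \<beta> * W)\<close> under centered noise. In
  \<open>M - 1\<close> samples the row difference has coefficient \<open>\<alpha>\<close>; in the
  swapped sample it has \<open>\<alpha> + 2 * \<beta>\<close>, as \<open>W\<close> is twice the
  difference there.\<close>

definition exponent_weight :: "nat \<Rightarrow> real \<Rightarrow> real \<times> real \<Rightarrow> real" where
  "exponent_weight M \<theta> t = exp (\<theta> * (real (M - 1) * (fst t)\<^sup>2 + (fst t + 2 * snd t)\<^sup>2))"

lemma weight_signal:
  assumes "M \<ge> 1"
  shows "(\<Sum>t\<in>exponents. signal_coeff t * exponent_weight M \<theta> t) = exp (real M * \<theta>)"
  using assms by (simp add: sum_exponents signal_coeff_def exponent_weight_def of_nat_diff mult.commute)

text \<open>On the exponents of \<open>cosh (z - 2 * w)\<close> the swapped sample has coefficient 3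
  in absolute value instead of 1, which adds \<open>9 - 1 = 8\<close> to the exponent.\<close>

lemma weight_rough:
  assumes "M \<ge> 1"
  shows "exp (- (real M * \<theta>)) * (\<Sum>t\<in>exponents. rough_coeff t * exponent_weight M \<theta> t) = exp (8 * \<theta>)"
  using assms by (simp add: sum_exponents rough_coeff_def exponent_weight_def of_nat_diff exp_add[symmetric] algebra_simps)

text \<open>The first-order terms in \<open>\<theta>\<close> cancel:
  \<open>5/4 * 8 + 1/4 * 24 - 16 = 0\<close>. Only second-order terms remain, with the factor
  \<open>M\<close> coming from \<open>exp (- (M * \<theta>))\<close>. The limit 1/24 keeps all
  arguments of the quadratic bound for \<open>exp\<close> at most 1.\<close>

lemma weight_fine:
  assumes M: "M \<ge> 2" and \<theta>: "0 \<le> \<theta>" "\<theta> \<le> 1/24"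
  shows "exp (- (real M * \<theta>)) * (\<Sum>t\<in>exponents. fine_coeff t * exponent_weight M \<theta> t)
    \<le> exp (140 * real M * \<theta>\<^sup>2)"
proof -
  have "exp (- (real M * \<theta>)) * (\<Sum>t\<in>exponents. fine_coeff t * exponent_weight M \<theta> t)
      = exp (- (real M * \<theta>)) * (5/4 * exp (real M * \<theta> + 8 * \<theta>) + 1/4 * exp (real M * \<theta> + 24 * \<theta>)
          - 1/2 * exp (real M * \<theta>) - exp (16 * \<theta>) + 1)"
    using M by (simp add: sum_exponents fine_coeff_def exponent_weight_def of_nat_diff algebra_simps)
  also have "\<dots> = 5/4 * exp (8 * \<theta>) + 1/4 * exp (24 * \<theta>) - 1/2 - exp (- (real M * \<theta>)) * (exp (16 * \<theta>) - 1)"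
    by (simp add: exp_add exp_minus field_simps)
  also have "\<dots> \<le> 5/4 * exp (8 * \<theta>) + 1/4 * exp (24 * \<theta>) - 1/2 - (1 - real M * \<theta>) * (exp (16 * \<theta>) - 1)"
    using exp_ge_add_one_self[of "- (real M * \<theta>)"] \<theta> by (intro diff_left_mono mult_right_mono) auto
  also have "\<dots> = 5/4 * exp (8 * \<theta>) + 1/4 * exp (24 * \<theta>) + 1/2 - exp (16 * \<theta>) + real M * \<theta> * (exp (16 * \<theta>) - 1)"
    by (simp add: algebra_simps)
  also have "\<dots> \<le> 5/4 * (1 + 8 * \<theta> + (8 * \<theta>)\<^sup>2) + 1/4 * (1 + 24 * \<theta> + (24 * \<theta>)\<^sup>2) + 1/2 - (1 + 16 * \<theta>)
      + real M * \<theta> * (16 * \<theta> + (16 * \<theta>)\<^sup>2)"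
  proof -
    have "exp (8 * \<theta>) \<le> 1 + 8 * \<theta> + (8 * \<theta>)\<^sup>2" "exp (24 * \<theta>) \<le> 1 + 24 * \<theta> + (24 * \<theta>)\<^sup>2"
      "exp (16 * \<theta>) \<le> 1 + 16 * \<theta> + (16 * \<theta>)\<^sup>2"
      using \<theta> exp_bound[of "8 * \<theta>"] exp_bound[of "24 * \<theta>"] exp_bound[of "16 * \<theta>"] by auto
    moreover have "1 + 16 * \<theta> \<le> exp (16 * \<theta>)" by (rule exp_ge_add_one_self)
    moreover have "real M * \<theta> * (exp (16 * \<theta>) - 1) \<le> real M * \<theta> * (16 * \<theta> + (16 * \<theta>)\<^sup>2)"
      using calculation \<theta> by (intro mult_left_mono) auto
    moreover have "5/4 * x + 1/4 * y + 1/2 - z + u \<le> 5/4 * x' + 1/4 * y' + 1/2 - z' + u'"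
      if "x \<le> x'" "y \<le> y'" "z' \<le> z" "u \<le> u'" for x x' y y' z z' u u' :: real
      using that by linarith
    ultimately show ?thesis by blast
  qed
  also have "\<dots> = 1 + 224 * \<theta>\<^sup>2 + real M * \<theta>\<^sup>2 * (16 + 256 * \<theta>)"
    by (simp add: power2_eq_square algebra_simps)
  also have "\<dots> \<le> 1 + 112 * (real M * \<theta>\<^sup>2) + real M * \<theta>\<^sup>2 * (16 + 12)"
  proof -
    \<comment> \<open>By \<open>M \<ge> 2\<close> the term \<open>224 * \<theta>\<^sup>2\<close> is
      absorbed into the one with \<open>M\<close>, giving
      \<open>140 = 112 + 16 + 12\<close>.\<close>
    have "2 * \<theta>\<^sup>2 \<le> real M * \<theta>\<^sup>2" using M by (intro mult_right_mono) auto
    moreover have "real M * \<theta>\<^sup>2 * (16 + 256 * \<theta>) \<le> real M * \<theta>\<^sup>2 * (16 + 12)"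
      using \<theta> by (intro mult_left_mono) auto
    ultimately show ?thesis by linarith
  qed
  also have "\<dots> = 1 + 140 * real M * \<theta>\<^sup>2" by simp
  also have "\<dots> \<le> exp (140 * real M * \<theta>\<^sup>2)" by (rule exp_ge_add_one_self)
  finally show ?thesis .
qed

text \<open>Needed to raise \<open>weight_fine\<close> to the power \<open>p\<close>, and not
  evident as some coefficients are negative. The expression increases with \<open>v\<close>, and at
  \<open>v = 1\<close> it is a polynomial in \<open>u\<close> that can be written with a
  square.\<close>

lemma weight_fine_nonneg:
  assumes M: "M \<ge> 2" and \<theta>: "0 \<le> \<theta>"
  shows "0 \<le> (\<Sum>t\<in>exponents. fine_coeff t * exponent_weight M \<theta> t)"
proof -
  define u where "u = exp (8 * \<theta>)"
  define v where "v = exp (real M * \<theta>)"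
  have u2: "exp (16 * \<theta>) = u\<^sup>2" and u3: "exp (24 * \<theta>) = u ^ 3"
    by (simp_all add: u_def exp_of_nat_mult[symmetric])
  have u: "u \<ge> 1" using \<theta> by (simp add: u_def)
  have v: "v \<ge> 1" using \<theta> by (simp add: v_def)
  have "(\<Sum>t\<in>exponents. fine_coeff t * exponent_weight M \<theta> t)
      = 5/4 * exp (real M * \<theta> + 8 * \<theta>) + 1/4 * exp (real M * \<theta> + 24 * \<theta>)
          - 1/2 * exp (real M * \<theta>) - exp (16 * \<theta>) + 1"
    using M by (simp add: sum_exponents fine_coeff_def exponent_weight_def of_nat_diff algebra_simps)
  also have "\<dots> = v * (5/4 * u + 1/4 * u ^ 3 - 1/2) - u\<^sup>2 + 1"
    unfolding exp_add u2 u3 u_def[symmetric] v_def[symmetric] by (simp add: algebra_simps)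
  finally have "(\<Sum>t\<in>exponents. fine_coeff t * exponent_weight M \<theta> t)
      = v * (5/4 * u + 1/4 * u ^ 3 - 1/2) - u\<^sup>2 + 1" .
  moreover have "1 * (5/4 * u + 1/4 * u ^ 3 - 1/2) \<le> v * (5/4 * u + 1/4 * u ^ 3 - 1/2)"
  proof (rule mult_right_mono[OF v])
    have "1 \<le> u ^ 3" by (rule one_le_power[OF u])
    then show "0 \<le> 5/4 * u + 1/4 * u ^ 3 - 1/2" using u by linarith
  qed
  moreover have "1 * (5/4 * u + 1/4 * u ^ 3 - 1/2) - u\<^sup>2 + 1 = 1/4 * u * (u - 2)\<^sup>2 + (u + 2) / 4"
    by (simp add: power2_eq_square power3_eq_cube field_simps)
  moreover have "0 \<le> 1/4 * u * (u - 2)\<^sup>2 + (u + 2) / 4" using u by simp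
  ultimately show ?thesis by linarith
qed

subsection \<open>Perfect recovery\<close>

text \<open>Rows \<open>2 * i - 1\<close> and \<open>2 * i\<close> form the pair \<open>i\<close>.
  For odd \<open>K\<close> the last row gets the number \<open>K div 2 + 1\<close> and has no
  partner.\<close>

definition cell :: "nat \<Rightarrow> nat" where "cell k = (k + 1) div 2"
definition side :: "nat \<Rightarrow> real" where "side k = (if even k then -1 else 1)"

lemma side_square: "(side k)\<^sup>2 = 1" by (simp add: side_def)

lemma sum_cell:
  fixes g :: "nat \<Rightarrow> real"
  assumes "i \<in> {1..K div 2}"
  shows "(\<Sum>k\<in>{1..K}. if cell k = i then g k else 0) = g (2 * i - 1) + g (2 * i)"
proof -
  have "(\<Sum>k\<in>{1..K}. if cell k = i then g k else 0) = (\<Sum>k\<in>{k \<in> {1..K}. cell k = i}. g k)"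
    by (simp add: sum.If_cases Int_def)
  also have "{k \<in> {1..K}. cell k = i} = {2 * i - 1, 2 * i}"
  proof (intro equalityI subsetI)
    fix k assume "k \<in> {k \<in> {1..K}. cell k = i}"
    then have "k = 2 * i - 1 \<or> k = 2 * i" by (auto simp: cell_def)
    then show "k \<in> {2 * i - 1, 2 * i}" by auto
  next
    fix k assume "k \<in> {2 * i - 1, 2 * i}"
    then show "k \<in> {k \<in> {1..K}. cell k = i}" using assms by (auto simp: cell_def)
  qed
  also have "sum g {2 * i - 1, 2 * i} = g (2 * i - 1) + g (2 * i)"
  proof -
    have "2 * i - 1 \<noteq> 2 * i" using assms by auto
    then show ?thesis by simp
  qed
  finally show ?thesis .
qed

definition pair_swap :: "nat \<Rightarrow> nat \<times> nat \<Rightarrow> nat \<Rightarrow> nat \<Rightarrow> nat" where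
  "pair_swap M = (\<lambda>(m0, i0). \<lambda>m\<in>{1..M}. if m = m0 then Transposition.transpose (2 * i0 - 1) (2 * i0) else id)"

lemma pair_swap_in_perm_tuples:
  assumes "i0 \<in> {1..K div 2}" shows "pair_swap M (m0, i0) \<in> perm_tuples K M"
proof -
  have "Transposition.transpose (2 * i0 - 1) (2 * i0) permutes {1..K}"
    using assms by (intro permutes_swap_id) auto
  then show ?thesis by (auto simp: pair_swap_def perm_tuples_def perms_def permutes_id)
qed

lemma pair_swap_apply:
  assumes "m \<in> {1..M}" "i0 \<ge> 1" "k \<ge> 1"
  shows "cell (pair_swap M (m0, i0) m k) = cell k"
    and "side (pair_swap M (m0, i0) m k) = (if m = m0 \<and> cell k = i0 then - side k else side k)"
proof -
  have "k = 2 * i0 - 1 \<or> k = 2 * i0 \<longleftrightarrow> cell k = i0" using assms by (auto simp: cell_def)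
  then show "cell (pair_swap M (m0, i0) m k) = cell k"
    and "side (pair_swap M (m0, i0) m k) = (if m = m0 \<and> cell k = i0 then - side k else side k)"
    using assms by (auto simp: pair_swap_def Transposition.transpose_def side_def cell_def)
qed

text \<open>Row \<open>2 * i0\<close> of sample \<open>m0\<close> tells the hypotheses apart: it is
  moved by its own transposition, and fixed by the identity and by the transposition of any other
  pair.\<close>

lemma pair_swap_separated:
  assumes "m0 \<in> {1..M}" "i0 \<in> {1..K div 2}" "i1 \<ge> 1"
    and "\<And>k m. k \<in> {1..K} \<Longrightarrow> m \<in> {1..M} \<Longrightarrow> pair_swap M (m0, i0) m k = pair_swap M (m1, i1) m k"
  shows "(m0, i0) = (m1, i1)"
proof -
  have "pair_swap M (m0, i0) m0 (2 * i0) = pair_swap M (m1, i1) m0 (2 * i0)"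
    using assms by (intro assms(4)) auto
  then have eq: "2 * i0 - 1 = (if m0 = m1 then Transposition.transpose (2 * i1 - 1) (2 * i1) else id) (2 * i0)"
    using assms(1) by (simp add: pair_swap_def)
  then have "m0 = m1" using assms(2) by (auto split: if_splits)
  moreover from this eq have "i0 = i1"
    using assms(2,3) by (auto simp: Transposition.transpose_def split: if_splits)
  ultimately show ?thesis by simp
qed

locale pair_model =
  fixes K M p :: nat and \<sigma> a :: real
  assumes M: "M \<ge> 2" and \<sigma>: "\<sigma> > 0"
begin

definition "row_index = {1..K} \<times> {1..M}"
text \<open>In contrast to the function \<open>cell\<close>, an element of \<open>cells\<close> is a
  pair of rows together with a coordinate; each of them carries its own sign.\<close>

definition "cells = {1..K div 2} \<times> {1..p}"
definition "\<theta> = a\<^sup>2 / \<sigma>\<^sup>2"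

text \<open>The spacing \<open>4 * a\<close> leaves a gap of \<open>2 * a\<close> in every
  coordinate between different pairs after shifts by at most \<open>a\<close>, as much as within a
  pair. Swaps within a pair do not affect the centers.\<close>

definition center :: "nat \<times> nat \<Rightarrow> nat \<Rightarrow> real" where
  "center = (\<lambda>(k, m) j. 4 * a * real (cell k))"

definition noise :: "(nat \<times> nat \<Rightarrow> nat \<Rightarrow> real) measure" where
  "noise = normal_array row_index p center \<sigma>"

text \<open>\<open>direction m0 e (\<alpha>, \<beta>)\<close> is the linear form \<open>\<alpha> Z + \<beta> W\<close> on the cell \<open>e\<close>, where \<open>Z\<close> is the sum
  over all samples of the differences of the two rows of the cell and \<open>W\<close> is twice the difference in
  sample \<open>m0\<close>.  Swapping the pair in sample \<open>m0\<close> turns \<open>Z\<close> into \<open>Z - W\<close>.\<close>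

definition direction :: "nat \<Rightarrow> nat \<times> nat \<Rightarrow> real \<times> real \<Rightarrow> nat \<times> nat \<Rightarrow> nat \<Rightarrow> real" where
  "direction m0 e t = (\<lambda>(k, m) j. if cell k = fst e \<and> j = snd e
     then a / \<sigma>\<^sup>2 * side k * (fst t + 2 * snd t * of_bool (m = m0)) else 0)"

definition linear_form :: "(nat \<times> nat \<Rightarrow> nat \<Rightarrow> real) \<Rightarrow> (nat \<times> nat \<Rightarrow> nat \<Rightarrow> real) \<Rightarrow> real" where
  "linear_form b y = (\<Sum>i\<in>row_index. \<Sum>j\<in>{1..p}. b i j * (y i j - center i j))"

text \<open>The sample number 0 is a dummy, as the exponent of \<open>W\<close> is 0.\<close>

definition "Z e = linear_form (direction 0 e (1, 0))"
definition "W m0 e = linear_form (direction m0 e (0, 1))"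

lemma finite_row_index: "finite row_index" and finite_cells: "finite cells"
  by (simp_all add: row_index_def cells_def)

lemma tilt_direction:
  "tilt row_index p center (direction m0 e t) y = exp (fst t * Z e y + snd t * W m0 e y)"
proof -
  have "linear_form (direction m0 e t) y = fst t * Z e y + snd t * W m0 e y"
    unfolding Z_def W_def linear_form_def sum_distrib_left sum.distrib[symmetric]
    by (intro sum.cong refl) (auto simp: direction_def algebra_simps)
  then show ?thesis by (simp add: tilt_def linear_form_def)
qed

lemma direction_orthogonal: "e \<noteq> e' \<Longrightarrow> direction m0 e t i j * direction m0 e' t' i j = 0"
  by (cases i; cases e; cases e') (auto simp: direction_def)

lemma direction_norm:
  assumes e: "e \<in> cells" and m0: "m0 \<in> {1..M}"
  shows "\<sigma>\<^sup>2 / 2 * (\<Sum>i\<in>row_index. \<Sum>j\<in>{1..p}. (direction m0 e t i j)\<^sup>2)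
    = \<theta> * (real (M - 1) * (fst t)\<^sup>2 + (fst t + 2 * snd t)\<^sup>2)"
proof -
  let ?c = "\<lambda>m. (fst t + 2 * snd t * of_bool (m = m0))\<^sup>2"
  have e': "fst e \<in> {1..K div 2}" "snd e \<in> {1..p}" using e by (auto simp: cells_def)
  have "(\<Sum>i\<in>row_index. \<Sum>j\<in>{1..p}. (direction m0 e t i j)\<^sup>2)
      = (\<Sum>k\<in>{1..K}. \<Sum>m\<in>{1..M}. \<Sum>j\<in>{1..p}. (direction m0 e t (k, m) j)\<^sup>2)"
    unfolding row_index_def by (subst sum.cartesian_product) (auto intro!: sum.cong)
  also have "\<dots> = (\<Sum>k\<in>{1..K}. \<Sum>m\<in>{1..M}. if cell k = fst e then (a / \<sigma>\<^sup>2)\<^sup>2 * ?c m else 0)"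
  proof (intro sum.cong refl)
    fix k m
    have "(\<Sum>j\<in>{1..p}. (direction m0 e t (k, m) j)\<^sup>2)
      = (\<Sum>j\<in>{1..p}. if j = snd e then (if cell k = fst e then (a / \<sigma>\<^sup>2)\<^sup>2 * ?c m else 0) else 0)"
      by (intro sum.cong refl) (auto simp: direction_def power_mult_distrib side_square power_divide)
    then show "(\<Sum>j\<in>{1..p}. (direction m0 e t (k, m) j)\<^sup>2) = (if cell k = fst e then (a / \<sigma>\<^sup>2)\<^sup>2 * ?c m else 0)"
      using e'(2) by simp
  qed
  also have "\<dots> = (\<Sum>k\<in>{1..K}. if cell k = fst e then (\<Sum>m\<in>{1..M}. (a / \<sigma>\<^sup>2)\<^sup>2 * ?c m) else 0)"
    by (intro sum.cong refl) auto
  also have "\<dots> = 2 * (\<Sum>m\<in>{1..M}. (a / \<sigma>\<^sup>2)\<^sup>2 * ?c m)"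
    by (subst sum_cell[OF e'(1)]) simp
  also have "(\<Sum>m\<in>{1..M}. (a / \<sigma>\<^sup>2)\<^sup>2 * ?c m) = (a / \<sigma>\<^sup>2)\<^sup>2 * (real (M - 1) * (fst t)\<^sup>2 + (fst t + 2 * snd t)\<^sup>2)"
  proof -
    have "(\<Sum>m\<in>{1..M}. ?c m) = ?c m0 + (\<Sum>m\<in>{1..M} - {m0}. ?c m)"
      using m0 by (intro sum.remove) auto
    also have "(\<Sum>m\<in>{1..M} - {m0}. ?c m) = (\<Sum>m\<in>{1..M} - {m0}. (fst t)\<^sup>2)"
      by (intro sum.cong) auto
    finally show ?thesis using m0 by (simp add: sum_distrib_left[symmetric])
  qed
  finally show ?thesis using \<sigma> by (simp add: \<theta>_def power_divide power2_eq_square)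
qed

text \<open>The coefficients may depend on the cell, because only the swapped pair needs a majorant.
  The factor \<open>exp (- (M * \<theta>))\<close> is the normalisation of one cell.\<close>

lemma integral_prod_hyperbolic:
  assumes m0: "m0 \<in> {1..M}"
  shows "has_bochner_integral noise
    (\<lambda>y. \<Prod>e\<in>cells. exp (- (real M * \<theta>)) * hyperbolic (c e) (Z e y) (W m0 e y))
    (\<Prod>e\<in>cells. exp (- (real M * \<theta>)) * (\<Sum>t\<in>exponents. c e t * exponent_weight M \<theta> t))"
proof -
  have "has_bochner_integral noise
     (\<lambda>y. \<Prod>e\<in>cells. \<Sum>t\<in>exponents. exp (- (real M * \<theta>)) * c e t * tilt row_index p center (direction m0 e t) y)
     (\<Prod>e\<in>cells. \<Sum>t\<in>exponents. exp (- (real M * \<theta>)) * c e t *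
        exp (\<sigma>\<^sup>2 / 2 * (\<Sum>i\<in>row_index. \<Sum>j\<in>{1..p}. (direction m0 e t i j)\<^sup>2)))"
    unfolding noise_def
    by (intro integral_prod_tilt \<sigma> finite_row_index finite_cells finite_exponents direction_orthogonal)
  moreover have "(\<Prod>e\<in>cells. \<Sum>t\<in>exponents. exp (- (real M * \<theta>)) * c e t *
        exp (\<sigma>\<^sup>2 / 2 * (\<Sum>i\<in>row_index. \<Sum>j\<in>{1..p}. (direction m0 e t i j)\<^sup>2)))
     = (\<Prod>e\<in>cells. exp (- (real M * \<theta>)) * (\<Sum>t\<in>exponents. c e t * exponent_weight M \<theta> t))"
    by (intro prod.cong refl, subst sum_distrib_left, intro sum.cong refl)
      (simp only: direction_norm[OF _ m0] exponent_weight_def mult.assoc)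
  ultimately show ?thesis
    by (simp add: tilt_direction hyperbolic_def sum_distrib_left mult.assoc)
qed

definition swap_density :: "nat \<times> nat \<Rightarrow> (nat \<times> nat \<Rightarrow> real) \<Rightarrow> (nat \<times> nat \<Rightarrow> nat \<Rightarrow> real) \<Rightarrow> real" where
  "swap_density h \<epsilon> = tilt_density row_index p \<sigma> center
     (\<lambda>i j. \<Sum>e\<in>cells. direction (fst h) e (\<epsilon> e, - (\<epsilon> e * of_bool (fst e = snd h))) i j)"

text \<open>Swapping changes the sign of one sample's coefficient, from \<open>\<epsilon> e\<close>
  to \<open>\<epsilon> e - 2 * \<epsilon> e\<close>. The squared norm is thus
  \<open>M * \<theta>\<close> for every cell, swapped or not.\<close>

lemma swap_density_eq:
  assumes m0: "m0 \<in> {1..M}" and \<epsilon>: "\<epsilon> \<in> cells \<rightarrow>\<^sub>E {-1, 1}"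
  shows "swap_density (m0, i0) \<epsilon> y
    = (\<Prod>e\<in>cells. exp (- (real M * \<theta>)) * exp (\<epsilon> e * (Z e y - of_bool (fst e = i0) * W m0 e y)))"
proof -
  let ?t = "\<lambda>e. (\<epsilon> e, - (\<epsilon> e * of_bool (fst e = i0)))"
  have norm: "\<sigma>\<^sup>2 / 2 * (\<Sum>i\<in>row_index. \<Sum>j\<in>{1..p}. (direction m0 e (?t e) i j)\<^sup>2) = real M * \<theta>" if "e \<in> cells" for e
  proof -
    have "\<epsilon> e \<in> {-1, 1}" using \<epsilon> that by (rule PiE_mem)
    then show ?thesis using M by (subst direction_norm[OF that m0]) (auto simp: of_nat_diff)
  qed
  have sq: "(\<Sum>i\<in>row_index. \<Sum>j\<in>{1..p}. (\<Sum>e\<in>cells. direction m0 e (?t e) i j)\<^sup>2)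
      = (\<Sum>e\<in>cells. \<Sum>i\<in>row_index. \<Sum>j\<in>{1..p}. (direction m0 e (?t e) i j)\<^sup>2)"
    by (rule sum_square_orthogonal_array[OF finite_cells direction_orthogonal])
  have "swap_density (m0, i0) \<epsilon> y
      = exp (\<Sum>e\<in>cells. - (\<sigma>\<^sup>2 / 2 * (\<Sum>i\<in>row_index. \<Sum>j\<in>{1..p}. (direction m0 e (?t e) i j)\<^sup>2)))
        * (\<Prod>e\<in>cells. tilt row_index p center (direction m0 e (?t e)) y)"
    unfolding swap_density_def tilt_density_def tilt_sum[OF finite_cells] fst_conv snd_conv sq
    by (simp add: sum_distrib_left sum_negf)
  also have "(\<Sum>e\<in>cells. - (\<sigma>\<^sup>2 / 2 * (\<Sum>i\<in>row_index. \<Sum>j\<in>{1..p}. (direction m0 e (?t e) i j)\<^sup>2)))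
      = (\<Sum>e\<in>cells. - (real M * \<theta>))"
    by (intro sum.cong refl) (simp only: norm)
  finally show ?thesis
    unfolding exp_sum[OF finite_cells] prod.distrib by (simp add: tilt_direction algebra_simps)
qed

text \<open>The signs of different cells are independent, so their average acts cell by cell and
  turns each exponential into a hyperbolic cosine.\<close>

lemma swap_density_average:
  assumes m0: "m0 \<in> {1..M}"
  shows "(\<Sum>\<epsilon>\<in>cells \<rightarrow>\<^sub>E {-1, 1}. swap_density (m0, i0) \<epsilon> y) / real (card (cells \<rightarrow>\<^sub>E {-1, 1::real}))
    = (\<Prod>e\<in>cells. exp (- (real M * \<theta>)) * cosh (Z e y - of_bool (fst e = i0) * W m0 e y))"
proof -
  let ?z = "\<lambda>e. Z e y - of_bool (fst e = i0) * W m0 e y"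
  have "(\<Sum>\<epsilon>\<in>cells \<rightarrow>\<^sub>E {-1, 1}. swap_density (m0, i0) \<epsilon> y)
      = (\<Sum>\<epsilon>\<in>cells \<rightarrow>\<^sub>E {-1, 1}. \<Prod>e\<in>cells. exp (- (real M * \<theta>)) * exp (\<epsilon> e * ?z e))"
    by (intro sum.cong refl swap_density_eq m0)
  also have "\<dots> = (\<Prod>e\<in>cells. \<Sum>s\<in>{-1, 1::real}. exp (- (real M * \<theta>)) * exp (s * ?z e))"
    by (subst prod_sum_PiE) (auto simp: finite_cells)
  also have "\<dots> = (\<Prod>e\<in>cells. 2 * (exp (- (real M * \<theta>)) * cosh (?z e)))"
    by (intro prod.cong refl) (simp add: cosh_field_def algebra_simps)
  also have "\<dots> = 2 ^ card cells * (\<Prod>e\<in>cells. exp (- (real M * \<theta>)) * cosh (?z e))"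
    by (simp only: prod.distrib prod_constant)
  finally show ?thesis by (simp add: card_signs[OF finite_cells])
qed

definition pair_means :: "(nat \<times> nat \<Rightarrow> real) \<Rightarrow> nat \<Rightarrow> nat \<Rightarrow> real" where
  "pair_means \<epsilon> = (\<lambda>k\<in>{1..K}. \<lambda>j\<in>{1..p}.
     4 * a * real (cell k) + (if (cell k, j) \<in> cells then a * side k * \<epsilon> (cell k, j) else 0))"

text \<open>Each coordinate alone contributes at least \<open>(2 * a)\<^sup>2\<close>: the
  difference is \<open>2 * a\<close> in absolute value within a pair and at least that between
  pairs.\<close>

lemma pair_means_in_Theta:
  assumes \<epsilon>: "\<epsilon> \<in> cells \<rightarrow>\<^sub>E {-1, 1}" and a: "2 * a\<^sup>2 * real p = \<sigma>\<^sup>2 * \<Delta>\<^sup>2"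
  shows "pair_means \<epsilon> \<in> Theta K p \<sigma> \<Delta>"
proof -
  have "\<Delta>\<^sup>2 \<le> (L2_set (\<lambda>j. pair_means \<epsilon> k j - pair_means \<epsilon> l j) {1..p})\<^sup>2 / (2 * \<sigma>\<^sup>2)"
    if kl: "k \<in> {1..K}" "l \<in> {1..K}" "k \<noteq> l" for k l
  proof -
    have coord: "4 * a\<^sup>2 \<le> (pair_means \<epsilon> k j - pair_means \<epsilon> l j)\<^sup>2" if j: "j \<in> {1..p}" for j
    proof -
      define d where "d i = (if (cell i, j) \<in> cells then side i * \<epsilon> (cell i, j) else 0)" for i
      have eps: "\<epsilon> (cell i, j) \<in> {-1, 1}" if "(cell i, j) \<in> cells" for i using \<epsilon> that by (rule PiE_mem)
      have d_abs: "\<bar>d i\<bar> \<le> 1" for i using eps[of i] by (auto simp: d_def side_def)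
      have eq: "pair_means \<epsilon> k j - pair_means \<epsilon> l j = a * (4 * (real (cell k) - real (cell l)) + (d k - d l))"
        using kl j by (simp add: pair_means_def d_def algebra_simps)
      have "2 \<le> \<bar>4 * (real (cell k) - real (cell l)) + (d k - d l)\<bar>"
      proof (cases "cell k = cell l")
        case False
        then have "real (cell k) - real (cell l) \<ge> 1 \<or> real (cell k) - real (cell l) \<le> -1" by linarith
        moreover have "-1 \<le> d k" "d k \<le> 1" "-1 \<le> d l" "d l \<le> 1"
          using d_abs[of k] d_abs[of l] by (simp_all add: abs_le_iff)
        ultimately show ?thesis by (elim disjE) (simp_all add: abs_if)
      next
        case True
        have "even k \<noteq> even l"
        proof
          assume "even k = even l"
          with True have "k = l" by (auto simp: cell_def elim!: evenE oddE)
          with kl show False by simp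
        qed
        \<comment> \<open>Two distinct rows share this pair number, so it is not that of a last row
          without partner.\<close>
        moreover have "cell k \<le> K div 2"
        proof -
          have "k \<noteq> l" "cell k = cell l" "k \<le> K" "l \<le> K" using kl True by auto
          then show ?thesis by (auto simp: cell_def)
        qed
        then have "(cell k, j) \<in> cells" using kl j by (auto simp: cells_def cell_def)
        ultimately have "\<bar>d k - d l\<bar> = 2" using True eps[of k] by (auto simp: d_def side_def split: if_splits)
        then show ?thesis using True by simp
      qed
      then have "2\<^sup>2 \<le> (4 * (real (cell k) - real (cell l)) + (d k - d l))\<^sup>2"
        by (metis abs_le_square_iff abs_numeral)
      from mult_left_mono[OF this, of "a\<^sup>2"] show ?thesis unfolding eq power_mult_distrib by simp
    qed
    have "2 * \<sigma>\<^sup>2 * \<Delta>\<^sup>2 = (\<Sum>j\<in>{1..p}. 4 * a\<^sup>2)" using a by (simp add: mult_ac)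
    also have "\<dots> \<le> (\<Sum>j\<in>{1..p}. (pair_means \<epsilon> k j - pair_means \<epsilon> l j)\<^sup>2)"
      by (rule sum_mono[OF coord])
    also have "\<dots> = (L2_set (\<lambda>j. pair_means \<epsilon> k j - pair_means \<epsilon> l j) {1..p})\<^sup>2"
      by (simp add: L2_set_def sum_nonneg)
    finally show ?thesis using \<sigma> by (simp add: pos_le_divide_eq mult.commute)
  qed
  then show ?thesis by (auto simp: Theta_def pair_means_def)
qed

lemma obs_dist_pair_swap:
  assumes i0: "i0 \<in> {1..K div 2}" and \<epsilon>: "\<epsilon> \<in> cells \<rightarrow>\<^sub>E {-1, 1}"
  shows "obs_dist K M p \<sigma> (pair_means \<epsilon>) (pair_swap M (m0, i0)) = density noise (\<lambda>y. ennreal (swap_density (m0, i0) \<epsilon> y))"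
  unfolding noise_def swap_density_def row_index_def
proof (rule obs_dist_eq_density[OF \<sigma>])
  fix k m j assume km: "k \<in> {1..K}" "m \<in> {1..M}" "j \<in> {1..p}"
  let ?\<pi> = "pair_swap M (m0, i0)" and ?\<epsilon> = "\<epsilon> (cell k, j)"
  have "?\<pi> m permutes {1..K}"
    using pair_swap_in_perm_tuples[OF i0, of M m0] km by (auto simp: perm_tuples_def perms_def)
  then have "?\<pi> m k \<in> {1..K}" using km(1) by (simp only: permutes_in_image)
  moreover have ps: "cell (?\<pi> m k) = cell k" "side (?\<pi> m k) = (if m = m0 \<and> cell k = i0 then - side k else side k)"
    using pair_swap_apply[of m M i0 k m0] km i0 by auto
  ultimately have "pair_means \<epsilon> (?\<pi> m k) j = 4 * a * real (cell k) + (if (cell k, j) \<in> cells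
      then a * (if m = m0 \<and> cell k = i0 then - side k else side k) * ?\<epsilon> else 0)"
    using km by (simp add: pair_means_def)
  moreover have "(\<Sum>e\<in>cells. direction m0 e (\<epsilon> e, - (\<epsilon> e * of_bool (fst e = i0))) (k, m) j)
     = (\<Sum>e\<in>cells. if e = (cell k, j) then a / \<sigma>\<^sup>2 * (if m = m0 \<and> cell k = i0 then - side k else side k) * ?\<epsilon> else 0)"
    by (intro sum.cong refl) (auto simp: direction_def)
  ultimately show "pair_means \<epsilon> (?\<pi> m k) j = center (k, m) j + \<sigma>\<^sup>2 *
      (\<Sum>e\<in>cells. direction (fst (m0, i0)) e (\<epsilon> e, - (\<epsilon> e * of_bool (fst e = snd (m0, i0)))) (k, m) j)"
    using \<sigma> by (simp add: finite_cells center_def)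
qed

text \<open>Outside the swapped pair the likelihood ratio is 1 and every cell integrates to 1. The
  second moment is therefore a \<open>p\<close>-th power, with no dependence on the number of
  pairs.\<close>

lemma exists_hard_swap:
  assumes K: "K \<ge> 2" and a: "2 * a\<^sup>2 * real p = \<sigma>\<^sup>2 * \<Delta>\<^sup>2"
    and c: "dominates_swap c"
    and B: "(exp (- (real M * \<theta>)) * (\<Sum>t\<in>exponents. c t * exponent_weight M \<theta> t)) ^ p \<le> B"
      "0 < B" "4 * B \<le> real ((M - 1) * (K div 2))"
    and est: "est \<in> estimators K M p"
  shows "\<exists>\<mu>\<in>Theta K p \<sigma> \<Delta>. \<exists>\<pi>\<in>perm_tuples K M.
    emeasure (obs_dist K M p \<sigma> \<mu> \<pi>) {y \<in> space (obs_space K M p). err K M (est y) \<pi> = 0} \<le> ennreal (1/2)"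
proof -
  \<comment> \<open>Samples are swapped from 2 onwards: the first permutation of every hypothesis is
    then the identity, as \<open>err_zero_unique\<close> requires, and at most one hypothesis is
    accepted.\<close>
  let ?J = "{2..M} \<times> {1..K div 2}" and ?G = "cells \<rightarrow>\<^sub>E {-1, 1::real}" and ?s = "exp (- (real M * \<theta>))"
  define S where "S h = {y \<in> space (obs_space K M p). err K M (est y) (pair_swap M h) = 0}" for h
  define q where "q y = (\<Prod>e\<in>cells. ?s * cosh (Z e y))" for y
  \<comment> \<open>Away from the swapped pair the quotient \<open>cosh Z ^ 2 / cosh Z\<close> is
    already a sum of exponentials, so \<open>signal_coeff\<close> loses nothing there.\<close>
  define coeff where "coeff h e = (if fst e = snd h then c else signal_coeff)" for h e :: "nat \<times> nat"
  define r where "r h y = (\<Prod>e\<in>cells. ?s * hyperbolic (coeff h e) (Z e y) (W (fst h) e y))" for h :: "nat \<times> nat" and y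
  have sets_noise: "sets noise = sets (obs_space K M p)"
    unfolding noise_def sets_normal_array obs_space_def row_index_def ..
  have s1: "?s * (\<Sum>t\<in>exponents. signal_coeff t * exponent_weight M \<theta> t) = 1"
    using weight_signal[of M \<theta>] M by (simp add: exp_minus)
  have q_int: "has_bochner_integral noise q 1"
    using integral_prod_hyperbolic[of 1 "\<lambda>_. signal_coeff"] M s1 by (simp add: hyperbolic_signal q_def[abs_def])
  have r_int: "has_bochner_integral noise (r h) (\<Prod>e\<in>cells. ?s * (\<Sum>t\<in>exponents. coeff h e t * exponent_weight M \<theta> t))"
    if "fst h \<in> {1..M}" for h
    unfolding r_def by (rule integral_prod_hyperbolic[OF that])
  have r_nonneg: "r h y \<ge> 0" for h y
    unfolding r_def coeff_def using hyperbolic_nonneg[OF c]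
    by (intro prod_nonneg) (auto simp: hyperbolic_signal)
  have Z_meas[measurable]: "tilt row_index p center b \<in> borel_measurable noise" for b
    unfolding noise_def by measurable
  have r_meas: "r h \<in> borel_measurable noise" for h
    unfolding r_def hyperbolic_def tilt_direction[symmetric] by measurable
  have "\<exists>h\<in>?J. \<exists>\<epsilon>\<in>?G. emeasure (density noise (swap_density h \<epsilon>)) (S h) \<le> ennreal (1/2)"
  proof (rule chi_square_fano[where q = q and r = r and B = B and V = 1])
    show "?J \<noteq> {}" using M K by auto
    show "finite ?G" by (rule finite_signs[OF finite_cells])
    show "?G \<noteq> {}" by (simp add: PiE_eq_empty_iff)
    show "swap_density h \<epsilon> \<in> borel_measurable noise" for h \<epsilon>
      unfolding swap_density_def noise_def by measurable
    show "swap_density h \<epsilon> y \<ge> 0" for h \<epsilon> y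
      unfolding swap_density_def by (rule tilt_density_nonneg)
    show "q \<in> borel_measurable noise"
      using q_int by (auto simp: has_bochner_integral_iff dest: borel_measurable_integrable)
    show "q y \<ge> 0" for y unfolding q_def by (intro prod_nonneg) auto
    then show "(\<integral>\<^sup>+ y. ennreal (q y) \<partial>noise) \<le> 1"
      using q_int by (subst nn_integral_eq_integral) (auto simp: has_bochner_integral_iff)
    show "S h \<in> sets noise" for h
      unfolding S_def sets_noise by (rule estimators_event[OF est, of "\<lambda>x. err K M x (pair_swap M h) = 0"])
    show "(\<integral>\<^sup>+ y. ennreal (r h y) \<partial>noise) \<le> ennreal B" if h: "h \<in> ?J" for h
    proof -
      have "fst h \<in> {1..M}" using h by auto
      from r_int[OF this] have "(\<integral>\<^sup>+ y. ennreal (r h y) \<partial>noise)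
          = ennreal (\<Prod>e\<in>cells. ?s * (\<Sum>t\<in>exponents. coeff h e t * exponent_weight M \<theta> t))"
        using r_nonneg by (subst nn_integral_eq_integral) (auto simp: has_bochner_integral_iff)
      also have "(\<Prod>e\<in>cells. ?s * (\<Sum>t\<in>exponents. coeff h e t * exponent_weight M \<theta> t))
          = (\<Prod>e\<in>cells. if fst e = snd h then ?s * (\<Sum>t\<in>exponents. c t * exponent_weight M \<theta> t) else 1)"
        by (intro prod.cong refl) (auto simp: coeff_def s1)
      also have "\<dots> = (\<Prod>i\<in>{1..K div 2}. \<Prod>j\<in>{1..p}. if i = snd h then ?s * (\<Sum>t\<in>exponents. c t * exponent_weight M \<theta> t) else 1)"
        unfolding cells_def by (subst prod.cartesian_product) (auto intro!: prod.cong)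
      also have "\<dots> = (\<Prod>i\<in>{1..K div 2}. if i = snd h then (?s * (\<Sum>t\<in>exponents. c t * exponent_weight M \<theta> t)) ^ p else 1)"
        by (intro prod.cong refl) auto
      also have "\<dots> = (?s * (\<Sum>t\<in>exponents. c t * exponent_weight M \<theta> t)) ^ p"
        using h by (auto simp: prod.delta)
      also have "ennreal \<dots> \<le> ennreal B" by (rule ennreal_leI[OF B(1)])
      finally show ?thesis .
    qed
    show "((\<Sum>\<epsilon>\<in>?G. swap_density h \<epsilon> y) / real (card ?G))\<^sup>2 \<le> r h y * q y" if h: "h \<in> ?J" for h y
    proof -
      obtain m0 i0 where h_eq: "h = (m0, i0)" by force
      have m0: "m0 \<in> {1..M}" using h by (auto simp: h_eq)
      have "((\<Sum>\<epsilon>\<in>?G. swap_density h \<epsilon> y) / real (card ?G))\<^sup>2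
          = (\<Prod>e\<in>cells. (?s * cosh (Z e y - of_bool (fst e = i0) * W m0 e y))\<^sup>2)"
        unfolding h_eq swap_density_average[OF m0] by (rule prod_power_distrib)
      also have "\<dots> \<le> (\<Prod>e\<in>cells. (?s * hyperbolic (coeff h e) (Z e y) (W m0 e y)) * (?s * cosh (Z e y)))"
      proof (rule prod_mono)
        fix e
        have "(cosh (Z e y - of_bool (fst e = i0) * W m0 e y))\<^sup>2 \<le> hyperbolic (coeff h e) (Z e y) (W m0 e y) * cosh (Z e y)"
          using c by (auto simp: coeff_def h_eq dominates_swap_def hyperbolic_signal power2_eq_square)
        from mult_left_mono[OF this, of "?s * ?s"]
        show "0 \<le> (?s * cosh (Z e y - of_bool (fst e = i0) * W m0 e y))\<^sup>2 \<and>
          (?s * cosh (Z e y - of_bool (fst e = i0) * W m0 e y))\<^sup>2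
            \<le> (?s * hyperbolic (coeff h e) (Z e y) (W m0 e y)) * (?s * cosh (Z e y))"
          by (simp add: power2_eq_square mult_ac)
      qed
      also have "\<dots> = r h y * q y" by (simp add: r_def q_def prod.distrib h_eq)
      finally show ?thesis .
    qed
    show "real (card {h \<in> ?J. y \<in> S h}) \<le> 1" if y: "y \<in> space noise" for y
    proof -
      have y': "y \<in> space (obs_space K M p)" using y sets_eq_imp_space_eq[OF sets_noise] by simp
      have "h = h'" if h: "h \<in> ?J" "y \<in> S h" and h': "h' \<in> ?J" "y \<in> S h'" for h h'
      proof -
        obtain m0 i0 m1 i1 where eq: "h = (m0, i0)" "h' = (m1, i1)" by force
        have "pair_swap M h m k = pair_swap M h' m k" if "k \<in> {1..K}" "m \<in> {1..M}" for k m
        proof (rule err_zero_unique[where \<pi>' = "pair_swap M h" and \<pi>'' = "pair_swap M h'",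
              OF estimators_in_perm_tuples[OF est y']])
          show "err K M (est y) (pair_swap M h) = 0" "err K M (est y) (pair_swap M h') = 0"
            using h h' by (auto simp: S_def)
          show "pair_swap M h 1 k = k" "pair_swap M h' 1 k = k" for k
            using h h' M by (auto simp: pair_swap_def eq)
        qed (use that K M in auto)
        then show ?thesis unfolding eq using h h' by (intro pair_swap_separated[of m0 M i0 K i1 m1]) (auto simp: eq)
      qed
      then have "card {h \<in> ?J. y \<in> S h} \<le> Suc 0"
        by (subst card_le_Suc0_iff_eq) auto
      then show ?thesis by simp
    qed
    show "4 * 1 * B \<le> real (card ?J)" using B(3) by (simp add: card_cartesian_product)
  qed (use B r_nonneg r_meas in auto)
  then obtain h \<epsilon> where h: "h \<in> ?J" and \<epsilon>: "\<epsilon> \<in> ?G"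
    and le: "emeasure (density noise (swap_density h \<epsilon>)) (S h) \<le> ennreal (1/2)" by blast
  obtain m0 i0 where h_eq: "h = (m0, i0)" by force
  have i0: "i0 \<in> {1..K div 2}" using h by (auto simp: h_eq)
  show ?thesis
  proof (intro bexI)
    show "emeasure (obs_dist K M p \<sigma> (pair_means \<epsilon>) (pair_swap M h))
        {y \<in> space (obs_space K M p). err K M (est y) (pair_swap M h) = 0} \<le> ennreal (1/2)"
      using le unfolding S_def h_eq obs_dist_pair_swap[OF i0 \<epsilon>] .
    show "pair_swap M h \<in> perm_tuples K M" unfolding h_eq by (rule pair_swap_in_perm_tuples[OF i0])
    show "pair_means \<epsilon> \<in> Theta K p \<sigma> \<Delta>" by (rule pair_means_in_Theta[OF \<epsilon> a])
  qed
qed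

end

text \<open>The second moment is kept below \<open>exp (L / 2)\<close>, the square root of
  \<open>n = K * M\<close>, while there are at least \<open>n / 6\<close> hypotheses. The
  requirement \<open>4 * sqrt n \<le> n / 6\<close> amounts to
  \<open>n \<ge> 24 ^ 2 = 576\<close>.\<close>

lemma minimax_perfect_lower_bound:
  assumes M: "M \<ge> 2" and p: "p \<ge> 1" and \<sigma>: "\<sigma> > 0" and K: "K \<ge> 576"
    and sep: "\<Delta>\<^sup>2 \<le> 1/20 * (ln (real K * real M) + sqrt (real p / real M * ln (real K * real M)))"
  shows "minimax_perfect K M p \<sigma> \<Delta> \<ge> ennreal (1/2)"
proof -
  define a where "a = sqrt (\<sigma>\<^sup>2 * \<Delta>\<^sup>2 / (2 * real p))"
  define n where "n = real K * real M"
  define L where "L = ln n"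
  interpret pair_model K M p \<sigma> a using M \<sigma> by unfold_locales
  have a2: "2 * a\<^sup>2 * real p = \<sigma>\<^sup>2 * \<Delta>\<^sup>2" using p by (simp add: a_def)
  have \<theta>p: "2 * (\<theta> * real p) = \<Delta>\<^sup>2"
    using a2 \<sigma> by (simp add: \<theta>_def field_simps)
  have \<theta>0: "\<theta> \<ge> 0" by (simp add: \<theta>_def)
  have n: "n \<ge> 576" using K M mult_mono[of 576 "real K" 1 "real M"] by (simp add: n_def)
  have L0: "L \<ge> 0" using n by (simp add: L_def)
  have sq: "real M * \<theta>\<^sup>2 * real p = real M * (\<Delta>\<^sup>2)\<^sup>2 / (4 * real p)"
    unfolding \<theta>p[symmetric] using p by (simp add: power2_eq_square)
  obtain c where c: "dominates_swap c"
    "(exp (- (real M * \<theta>)) * (\<Sum>t\<in>exponents. c t * exponent_weight M \<theta> t)) ^ p \<le> exp (L / 2)"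
  proof -
    have rough: "(exp (- (real M * \<theta>)) * (\<Sum>t\<in>exponents. rough_coeff t * exponent_weight M \<theta> t)) ^ p \<le> exp (L / 2)"
      if "8 * (\<theta> * real p) \<le> L / 2"
    proof -
      have "exp (8 * \<theta>) ^ p = exp (real p * (8 * \<theta>))" by (rule exp_of_nat_mult[symmetric])
      then show ?thesis using that M by (simp add: weight_rough mult_ac)
    qed
    consider "\<Delta>\<^sup>2 \<le> 2 * (1/20) * L" | "(\<Delta>\<^sup>2)\<^sup>2 \<le> 4 * (1/20)\<^sup>2 * (real p / real M * L)"
      using separation_cases[OF sep] L0 by (auto simp: L_def n_def)
    then show thesis
    proof cases
      case 1
      then have "8 * (\<theta> * real p) \<le> L / 2" using \<theta>p L0 by simp
      from that[OF dominates_swap_rough rough[OF this]] show thesis .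
    next
      case 2
      have "real M * \<theta>\<^sup>2 * real p \<le> real M * (4 * (1/20)\<^sup>2 * (real p / real M * L)) / (4 * real p)"
        unfolding sq using 2 by (intro divide_right_mono mult_left_mono) auto
      also have "\<dots> = L / 400" using p M by (simp add: field_simps power2_eq_square)
      finally have small: "real M * \<theta>\<^sup>2 * real p \<le> L / 400" .
      show thesis
      proof (cases "\<theta> \<le> 1/24")
        case True
        have s0: "0 \<le> exp (- (real M * \<theta>)) * (\<Sum>t\<in>exponents. fine_coeff t * exponent_weight M \<theta> t)"
          using weight_fine_nonneg[OF M \<theta>0] by simp
        have "(exp (- (real M * \<theta>)) * (\<Sum>t\<in>exponents. fine_coeff t * exponent_weight M \<theta> t)) ^ p
            \<le> exp (140 * real M * \<theta>\<^sup>2) ^ p"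
          by (intro power_mono weight_fine M \<theta>0 True s0)
        also have "\<dots> = exp (140 * (real M * \<theta>\<^sup>2 * real p))"
          by (simp add: exp_of_nat_mult[symmetric] mult_ac)
        also have "\<dots> \<le> exp (L / 2)" using small L0 by simp
        finally show thesis by (rule that[OF dominates_swap_fine])
      next
        case False
        have "8 * (\<theta> * real p) \<le> 96 * (real M * \<theta>\<^sup>2 * real p)"
        proof -
          have "1 \<le> 12 * real M * \<theta>"
            using False M \<theta>0 mult_mono[of 2 "real M" "1/24" \<theta>] by simp
          from mult_right_mono[OF this, of "8 * (\<theta> * real p)"] \<theta>0 show ?thesis
            by (simp add: power2_eq_square mult_ac)
        qed
        then have "8 * (\<theta> * real p) \<le> L / 2" using small L0 by linarith
        from that[OF dominates_swap_rough rough[OF this]] show thesis .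
      qed
    qed
  qed
  have B2: "exp (L / 2) * exp (L / 2) = n" using n by (simp add: exp_add[symmetric] L_def)
  have "exp (L / 2) \<ge> 24"
    by (rule power2_le_imp_le) (use B2 n in \<open>simp_all add: power2_eq_square\<close>)
  then have "24 * exp (L / 2) \<le> n"
    using mult_right_mono[of 24 "exp (L / 2)" "exp (L / 2)"] B2 by simp
  moreover have "n \<le> 6 * real ((M - 1) * (K div 2))"
  proof -
    \<comment> \<open>Rounding in \<open>K div 2\<close> costs at most a factor 3/2, and giving up
      the first sample at most a factor 2.\<close>
    have "K * M \<le> (3 * (K div 2)) * (2 * (M - 1))" using K M by (intro mult_mono) auto
    then have "real (K * M) \<le> real (6 * ((M - 1) * (K div 2)))"
      by (intro of_nat_mono) (simp add: mult_ac)
    then show ?thesis by (simp add: n_def)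
  qed
  ultimately have N: "4 * exp (L / 2) \<le> real ((M - 1) * (K div 2))" by simp
  show ?thesis
  proof (rule minimax_perfectI[OF \<sigma>])
    fix est assume "est \<in> estimators K M p"
    then show "\<exists>\<mu>\<in>Theta K p \<sigma> \<Delta>. \<exists>\<pi>\<in>perm_tuples K M.
      emeasure (obs_dist K M p \<sigma> \<mu> \<pi>) {y \<in> space (obs_space K M p). err K M (est y) \<pi> = 0} \<le> ennreal (1/2)"
      using K by (intro exists_hard_swap[OF _ a2 c _ N]) auto
  qed
qed

theorem theoremA2:
  "(\<exists>(c::real)>0. \<exists>(C::real)>0. \<exists>(K0::nat)>0.
      \<forall>(K::nat) (M::nat) (p::nat) (\<sigma>::real) (\<Delta>::real).
        M \<ge> 2 \<longrightarrow> p \<ge> 1 \<longrightarrow> \<sigma> > 0 \<longrightarrow> \<Delta> > 0 \<longrightarrow>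
        \<Delta>\<^sup>2 \<le> c * (ln (real K * real M) + sqrt (real p / real M * ln (real K * real M))) \<longrightarrow>
        K \<ge> K0 \<longrightarrow>
        minimax_perfect K M p \<sigma> \<Delta> \<ge> ennreal C)
   \<and>
   (\<exists>(c::real)>0. \<exists>(c'::real)>0. \<exists>(C::real)>0. \<exists>(K0::nat)>0.
      \<forall>(K::nat) (M::nat) (p::nat) (\<sigma>::real) (\<Delta>::real).
        M \<ge> 2 \<longrightarrow> p \<ge> 1 \<longrightarrow> \<sigma> > 0 \<longrightarrow> \<Delta> > 0 \<longrightarrow>
        real p \<ge> c * ln (real K) \<longrightarrow> K \<ge> K0 \<longrightarrow>
        \<Delta>\<^sup>2 \<le> c' * (ln (real K) + sqrt (real p / real M * ln (real K))) \<longrightarrow>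
        minimax_partial K M p \<sigma> \<Delta> \<ge> ennreal C)"
proof (rule conjI)
  show "\<exists>(c::real)>0. \<exists>(C::real)>0. \<exists>(K0::nat)>0.
      \<forall>(K::nat) (M::nat) (p::nat) (\<sigma>::real) (\<Delta>::real).
        M \<ge> 2 \<longrightarrow> p \<ge> 1 \<longrightarrow> \<sigma> > 0 \<longrightarrow> \<Delta> > 0 \<longrightarrow>
        \<Delta>\<^sup>2 \<le> c * (ln (real K * real M) + sqrt (real p / real M * ln (real K * real M))) \<longrightarrow>
        K \<ge> K0 \<longrightarrow>
        minimax_perfect K M p \<sigma> \<Delta> \<ge> ennreal C"
    by (rule exI[of _ "1/20"], intro conjI, simp, rule exI[of _ "1/2"], intro conjI, simp, rule exI[of _ 576],
        intro conjI allI impI, simp, rule minimax_perfect_lower_bound, assumption+)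
  show "\<exists>(c::real)>0. \<exists>(c'::real)>0. \<exists>(C::real)>0. \<exists>(K0::nat)>0.
      \<forall>(K::nat) (M::nat) (p::nat) (\<sigma>::real) (\<Delta>::real).
        M \<ge> 2 \<longrightarrow> p \<ge> 1 \<longrightarrow> \<sigma> > 0 \<longrightarrow> \<Delta> > 0 \<longrightarrow>
        real p \<ge> c * ln (real K) \<longrightarrow> K \<ge> K0 \<longrightarrow>
        \<Delta>\<^sup>2 \<le> c' * (ln (real K) + sqrt (real p / real M * ln (real K))) \<longrightarrow>
        minimax_partial K M p \<sigma> \<Delta> \<ge> ennreal C"
    by (rule exI[of _ 32], intro conjI, simp, rule exI[of _ "1/64"], intro conjI, simp,
        rule exI[of _ "1/16/2"], intro conjI, simp, rule exI[of _ 65536],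
        intro conjI allI impI, simp, rule minimax_partial_lower_bound, assumption+)
qed

end
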